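(* Let $F$ be a forest. Then $AR_d(F) = e(F) - 1$, unless $F$ is a star (of any size) or a matching with precisely two edges, in which case $AR_d(F) = e(F)$.
   Context: All graphs are finite and simple; $e(F)$ denotes the number of edges of $F$. A proper edge colouring assigns colours to edges so that edges sharing a vertex receive distinct colours. A copy of $F$ in an edge-coloured graph is rainbow if all its edges have distinct colours. The degree anti-Ramsey number $AR_d(F)$ is the smallest integer $k$ for which there exists a graph $G$ with maximum degree at most $k$ such that every proper edge colouring of $G$ contains a rainbow copy of $F$. A star is a graph $K_{1,t}$ for some $t\ge 1$.
   Formalization: "Star" and "matching with two edges" are read up to isolated vertices (an edge plus an isolated vertex has AR_d = 1, not e(F) − 1 = 0), and for a forest without edges the value is 0 instead of e(F) − 1 = −1. *)

theory Defs
  imports Main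
begin

type_synonym 'a ugraph = "'a set \<times> 'a set set"

abbreviation verts :: "'a ugraph \<Rightarrow> 'a set" where
  "verts \<equiv> fst"

abbreviation edges :: "'a ugraph \<Rightarrow> 'a set set" where
  "edges \<equiv> snd"

definition simple_graph :: "'a ugraph \<Rightarrow> bool" where
  "simple_graph G \<longleftrightarrow> finite (verts G) \<and> (\<forall>e\<in>edges G. e \<subseteq> verts G \<and> card e = 2)"

definition num_edges :: "'a ugraph \<Rightarrow> nat" where
  "num_edges G = card (edges G)"

definition degree :: "'a ugraph \<Rightarrow> 'a \<Rightarrow> nat" where
  "degree G v = card {e \<in> edges G. v \<in> e}"

definition max_degree_le :: "'a ugraph \<Rightarrow> nat \<Rightarrow> bool" where
  "max_degree_le G k \<longleftrightarrow> (\<forall>v\<in>verts G. degree G v \<le> k)"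

definition subgraph :: "'a ugraph \<Rightarrow> 'a ugraph \<Rightarrow> bool" where
  "subgraph H G \<longleftrightarrow> simple_graph H \<and> verts H \<subseteq> verts G \<and> edges H \<subseteq> edges G"

definition isomorphic :: "'a ugraph \<Rightarrow> 'b ugraph \<Rightarrow> bool" where
  "isomorphic F H \<longleftrightarrow>
     (\<exists>f. bij_betw f (verts F) (verts H) \<and> edges H = (\<lambda>e. f ` e) ` edges F)"

definition proper_edge_colouring :: "'a ugraph \<Rightarrow> ('a set \<Rightarrow> 'c) \<Rightarrow> bool" where
  "proper_edge_colouring G c \<longleftrightarrow>
     (\<forall>e\<in>edges G. \<forall>f\<in>edges G. e \<noteq> f \<and> e \<inter> f \<noteq> {} \<longrightarrow> c e \<noteq> c f)"

definition rainbow :: "('a set \<Rightarrow> 'c) \<Rightarrow> 'a ugraph \<Rightarrow> bool" where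
  "rainbow c H \<longleftrightarrow> inj_on c (edges H)"

definition has_rainbow_copy :: "'a ugraph \<Rightarrow> 'b ugraph \<Rightarrow> ('b set \<Rightarrow> 'c) \<Rightarrow> bool" where
  "has_rainbow_copy F G c \<longleftrightarrow> (\<exists>H. subgraph H G \<and> isomorphic F H \<and> rainbow c H)"

text \<open>Every finite graph is isomorphic to one with vertices in \<^typ>\<open>nat\<close>, and a colouring of
  finitely many edges uses only finitely many colours, so \<^typ>\<open>nat\<close> suffices both for the vertices
  of the host graph and for the colours.\<close>

definition AR_d :: "'a ugraph \<Rightarrow> nat" where
  "AR_d F = (LEAST k. \<exists>G :: nat ugraph. simple_graph G \<and> max_degree_le G k \<and>
     (\<forall>c :: nat set \<Rightarrow> nat. proper_edge_colouring G c \<longrightarrow> has_rainbow_copy F G c))"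

definition is_cycle :: "'a ugraph \<Rightarrow> 'a list \<Rightarrow> bool" where
  "is_cycle G vs \<longleftrightarrow> 3 \<le> length vs \<and> distinct vs \<and>
     (\<forall>i < length vs. {vs ! i, vs ! (Suc i mod length vs)} \<in> edges G)"

definition forest :: "'a ugraph \<Rightarrow> bool" where
  "forest G \<longleftrightarrow> simple_graph G \<and> (\<nexists>vs. is_cycle G vs)"

definition is_star :: "'a ugraph \<Rightarrow> bool" where
  "is_star G \<longleftrightarrow> (\<exists>z L. finite L \<and> L \<noteq> {} \<and> z \<notin> L \<and>
     verts G = insert z L \<and> edges G = (\<lambda>x. {z, x}) ` L)"

definition is_matching :: "'a ugraph \<Rightarrow> bool" where
  "is_matching G \<longleftrightarrow> (\<forall>e\<in>edges G. \<forall>f\<in>edges G. e \<noteq> f \<longrightarrow> e \<inter> f = {})"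

text \<open>Isolated vertices change neither the number of edges nor the degree anti-Ramsey number, so
  the exceptional cases have to be read up to isolated vertices: a star together with an isolated
  vertex is still exceptional. For matchings this is built into \<^const>\<open>is_matching\<close>; for stars,
  isolated vertices are deleted first.\<close>

definition delete_isolated :: "'a ugraph \<Rightarrow> 'a ugraph" where
  "delete_isolated G = ({v \<in> verts G. \<exists>e\<in>edges G. v \<in> e}, edges G)"

end

theory Submission
  imports Defs "HOL-Combinatorics.Permutations"
begin

text \<open>
  Write \<open>d = e(F) - 1\<close>. The lower bound \<open>AR_d(F) \<ge> d\<close> is Vizing's theorem: a graph of maximum degree
  \<open>k < d\<close> has a proper edge colouring with \<open>k + 1 < e(F)\<close> colours.

  For the upper bound the host consists of disjoint copies, one for each component of \<open>F\<close>, of a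
  \<open>d\<close>-regular graph of large girth in which no proper edge colouring gives all adjacent vertices
  the same set of colours. Every vertex sees \<open>d\<close> colours, so all edges of \<open>F\<close> but the last can be
  embedded greedily, each with a colour not used before; large girth makes the result injective.
  For the last edge, a leaf edge \<open>yz\<close>, one first uses a colour that does not occur at the image of
  \<open>y\<close>: such a colour exists next to that image because two adjacent vertices see different colour
  sets, and it can be placed because \<open>F\<close>, not being a star, has an edge avoiding \<open>y\<close>.

  Large girth is used only in the form that every nonempty set \<open>C\<close> of few edges spans more than
  \<open>|C|\<close> vertices.
\<close>

section \<open>Edge sets and edge colourings\<close>

definition edge_set :: "'a set set \<Rightarrow> bool" where
  "edge_set E \<longleftrightarrow> finite E \<and> (\<forall>e\<in>E. card e = 2)"

definition incident :: "'a set set \<Rightarrow> 'a \<Rightarrow> 'a set set" where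
  "incident E v = {e \<in> E. v \<in> e}"

lemma in_incident_iff [simp]: "e \<in> incident E v \<longleftrightarrow> e \<in> E \<and> v \<in> e"
  by (simp add: incident_def)

lemma incident_mono: "A \<subseteq> B \<Longrightarrow> incident A v \<subseteq> incident B v"
  by auto

lemma incident_insert:
  "incident (insert e E) v = (if v \<in> e then insert e (incident E v) else incident E v)"
  by auto

lemma incident_Diff: "incident (A - B) v = incident A v - B"
  by auto

lemma incident_eq_empty_iff: "incident E v = {} \<longleftrightarrow> v \<notin> \<Union>E"
  by auto

lemma edge_set_subset: "edge_set E \<Longrightarrow> A \<subseteq> E \<Longrightarrow> edge_set A"
  by (auto simp: edge_set_def intro: finite_subset)

lemma edge_set_insert: "edge_set (insert {a, b} E) \<longleftrightarrow> a \<noteq> b \<and> edge_set E"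
  by (auto simp: edge_set_def)

lemma finite_incident: "edge_set E \<Longrightarrow> finite (incident E v)"
  by (simp add: edge_set_def incident_def)

lemma edge_set_card: "edge_set E \<Longrightarrow> e \<in> E \<Longrightarrow> card e = 2"
  by (simp add: edge_set_def)

lemma edge_set_neq: "edge_set E \<Longrightarrow> {a, b} \<in> E \<Longrightarrow> a \<noteq> b"
  using edge_set_card by fastforce

lemma finite_Union_edge_set: "edge_set E \<Longrightarrow> finite (\<Union>E)"
  by (auto simp: edge_set_def card_ge_0_finite)

lemma edge_at_vertexE:
  assumes "edge_set E" "e \<in> E" "v \<in> e"
  obtains w where "e = {v, w}" "w \<noteq> v"
  using edge_set_card[OF assms(1,2)] assms(3)
  by (metis card_2_iff doubleton_eq_iff insertE singletonD)

lemma card_incident_mono: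
  "edge_set E \<Longrightarrow> A \<subseteq> E \<Longrightarrow> card (incident A v) \<le> card (incident E v)"
  by (intro card_mono incident_mono finite_incident)

lemma sum_card_incident:
  assumes "edge_set E" "finite W" "\<Union>E \<subseteq> W"
  shows "(\<Sum>v\<in>W. card (incident E v)) = 2 * card E"
proof -
  have "(\<Sum>v\<in>W. card {e \<in> E. v \<in> e}) = (\<Sum>e\<in>E. 2)"
  proof (rule sum_multicount_gen)
    show "\<forall>e\<in>E. card {v \<in> W. v \<in> e} = 2"
    proof
      fix e assume "e \<in> E"
      then have "{v \<in> W. v \<in> e} = e" using assms(3) by blast
      then show "card {v \<in> W. v \<in> e} = 2" using \<open>e \<in> E\<close> edge_set_card[OF assms(1)] by simp
    qed
  qed (use assms in \<open>auto simp: edge_set_def\<close>)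
  then show ?thesis by (simp add: incident_def)
qed

lemma even_card_Union_matching:
  assumes "edge_set M" "disjoint M"
  shows "even (card (\<Union>M))"
proof -
  have "card (\<Union>M) = (\<Sum>e\<in>M. card e)"
    using assms by (intro card_Union_disjoint) (auto simp: edge_set_def intro: card_ge_0_finite)
  also have "\<dots> = (\<Sum>e\<in>M. 2)"
    using assms(1) by (intro sum.cong) (simp_all add: edge_set_card)
  finally show ?thesis by simp
qed

lemma even_card_closed_under_matching:
  assumes "edge_set E" "finite B" and matching: "M \<subseteq> E" "disjoint M" "B \<subseteq> \<Union>M"
    and closed: "\<And>p q. {p, q} \<in> E \<Longrightarrow> p \<in> B \<Longrightarrow> q \<in> B"
  shows "even (card B)"
proof -
  let ?M = "{e \<in> M. e \<subseteq> B}"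
  have "edge_set ?M" using assms(1) by (rule edge_set_subset) (use matching(1) in blast)
  moreover have "disjoint ?M" using matching(2) by (rule pairwise_subset) blast
  moreover have "\<Union>?M = B"
  proof (intro equalityI subsetI)
    fix p assume "p \<in> B"
    then obtain e where e_covers_p: "e \<in> M" "p \<in> e" using matching(3) by blast
    then obtain q where "e = {p, q}" using matching(1) edge_at_vertexE[OF assms(1)] by blast
    then have "e \<subseteq> B" using e_covers_p(1) matching(1) \<open>p \<in> B\<close> closed[of p q] by auto
    then show "p \<in> \<Union>?M" using e_covers_p by blast
  qed auto
  ultimately show ?thesis using even_card_Union_matching by metis
qed

definition proper_colouring :: "'a set set \<Rightarrow> ('a set \<Rightarrow> 'c) \<Rightarrow> bool" where
  "proper_colouring E c \<longleftrightarrow> (\<forall>v. inj_on c (incident E v))"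

definition colours_at :: "'a set set \<Rightarrow> ('a set \<Rightarrow> 'c) \<Rightarrow> 'a \<Rightarrow> 'c set" where
  "colours_at E c v = c ` incident E v"

lemma proper_colouringD:
  "proper_colouring E c \<Longrightarrow> e \<in> E \<Longrightarrow> f \<in> E \<Longrightarrow> v \<in> e \<Longrightarrow> v \<in> f \<Longrightarrow> c e = c f \<Longrightarrow> e = f"
  unfolding proper_colouring_def by (meson in_incident_iff inj_onD)

lemma proper_edge_colouring_iff: "proper_edge_colouring G c \<longleftrightarrow> proper_colouring (edges G) c"
proof
  assume "proper_edge_colouring G c"
  then show "proper_colouring (edges G) c"
    unfolding proper_edge_colouring_def proper_colouring_def inj_on_def
    by (metis disjoint_iff in_incident_iff)
next
  assume "proper_colouring (edges G) c"
  then show "proper_edge_colouring G c"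
    unfolding proper_edge_colouring_def by (metis disjoint_iff proper_colouringD)
qed

lemma proper_colouringI:
  "(\<And>e f v. e \<in> E \<Longrightarrow> f \<in> E \<Longrightarrow> v \<in> e \<Longrightarrow> v \<in> f \<Longrightarrow> c e = c f \<Longrightarrow> e = f) \<Longrightarrow> proper_colouring E c"
  unfolding proper_colouring_def by (meson in_incident_iff inj_onI)

lemma proper_colouring_subset: "proper_colouring E c \<Longrightarrow> A \<subseteq> E \<Longrightarrow> proper_colouring A c"
  unfolding proper_colouring_def by (meson incident_mono inj_on_subset)

lemma card_colours_at: "proper_colouring E c \<Longrightarrow> card (colours_at E c v) = card (incident E v)"
  by (simp add: proper_colouring_def colours_at_def card_image)

lemma finite_colours_at: "edge_set E \<Longrightarrow> finite (colours_at E c v)"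
  by (simp add: colours_at_def finite_incident)

lemma colours_at_mono: "A \<subseteq> E \<Longrightarrow> colours_at A c v \<subseteq> colours_at E c v"
  by (auto simp: colours_at_def)

lemma in_colours_at_iff: "i \<in> colours_at E c v \<longleftrightarrow> (\<exists>e\<in>E. v \<in> e \<and> c e = i)"
  by (auto simp: colours_at_def)

lemma in_colours_atI: "e \<in> E \<Longrightarrow> v \<in> e \<Longrightarrow> c e \<in> colours_at E c v"
  by (simp add: colours_at_def)

lemma in_colours_atE:
  assumes "edge_set E" "i \<in> colours_at E c v"
  obtains w where "{v, w} \<in> E" "c {v, w} = i"
proof -
  obtain e where "e \<in> E" "v \<in> e" "c e = i" using assms(2) by (auto simp: in_colours_at_iff)
  then show thesis using edge_at_vertexE[OF assms(1)] that by metis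
qed

lemma card_incident_colour_class:
  assumes "proper_colouring E c"
  shows "card (incident {e \<in> E. c e \<in> S} v) = card (S \<inter> colours_at E c v)"
proof -
  have "card (incident {e \<in> E. c e \<in> S} v) = card (colours_at {e \<in> E. c e \<in> S} c v)"
    using proper_colouring_subset[OF assms] by (simp add: card_colours_at)
  also have "colours_at {e \<in> E. c e \<in> S} c v = S \<inter> colours_at E c v"
    by (auto simp: colours_at_def)
  finally show ?thesis .
qed

lemma disjoint_colour_class:
  assumes "proper_colouring E c"
  shows "disjoint {e \<in> E. c e = k}"
proof (rule disjointI)
  fix e f assume "e \<in> {e \<in> E. c e = k}" "f \<in> {e \<in> E. c e = k}" "e \<noteq> f"
  then have "e \<in> E" "f \<in> E" "c e = c f" "e \<noteq> f" by auto
  then show "e \<inter> f = {}" using proper_colouringD[OF assms] by (metis disjoint_iff)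
qed

lemma Union_colour_class: "\<Union>{e \<in> E. c e = k} = {v. k \<in> colours_at E c v}"
  by (auto simp: in_colours_at_iff)

lemma incident_image:
  assumes "inj_on f V" "\<Union>E \<subseteq> V" "v \<in> V"
  shows "incident ((`) f ` E) (f v) = (`) f ` incident E v"
proof -
  have "f v \<in> f ` e \<longleftrightarrow> v \<in> e" if "e \<in> E" for e
    using assms that by (intro inj_on_image_mem_iff[of f V]) auto
  then show ?thesis by (auto simp: incident_def)
qed

lemma inj_on_image_edges: "inj_on f V \<Longrightarrow> \<Union>E \<subseteq> V \<Longrightarrow> inj_on ((`) f) E"
  by (meson inj_on_image inj_on_subset)

lemma edge_set_image:
  assumes "inj_on f (\<Union>E)" "edge_set E"
  shows "edge_set ((`) f ` E)"
proof -
  have "card (f ` e) = 2" if "e \<in> E" for e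
    using assms that by (metis Union_upper card_image edge_set_card inj_on_subset)
  then show ?thesis using assms(2) by (auto simp: edge_set_def)
qed

lemma card_incident_image:
  assumes "inj_on f V" "\<Union>E \<subseteq> V" "v \<in> V"
  shows "card (incident ((`) f ` E) (f v)) = card (incident E v)"
proof -
  have "inj_on ((`) f) (incident E v)"
    using inj_on_image_edges[OF assms(1,2)] by (rule inj_on_subset) auto
  then show ?thesis by (simp add: incident_image[OF assms] card_image)
qed

lemma colours_at_image:
  assumes "inj_on f V" "\<Union>E \<subseteq> V" "v \<in> V"
  shows "colours_at ((`) f ` E) c (f v) = colours_at E (c \<circ> (`) f) v"
  by (simp add: colours_at_def incident_image[OF assms] image_comp)

lemma proper_colouring_comp_image:
  assumes "inj_on f V" "\<Union>E \<subseteq> V" and proper: "proper_colouring ((`) f ` E) c"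
  shows "proper_colouring E (c \<circ> (`) f)"
  unfolding proper_colouring_def
proof
  fix v
  show "inj_on (c \<circ> (`) f) (incident E v)"
  proof (cases "v \<in> V")
    case True
    have "inj_on c ((`) f ` incident E v)"
      using proper incident_image[OF assms(1,2) True] unfolding proper_colouring_def by metis
    moreover have "inj_on ((`) f) (incident E v)"
      using inj_on_image_edges[OF assms(1,2)] by (rule inj_on_subset) auto
    ultimately show ?thesis by (intro comp_inj_on)
  next
    case False
    then have "incident E v = {}" using assms(2) by (auto simp: incident_def)
    then show ?thesis by simp
  qed
qed

section \<open>Connected components\<close>

definition component :: "'a set set \<Rightarrow> 'a \<Rightarrow> 'a set" where
  "component E v = {(a, b). {a, b} \<in> E}\<^sup>* `` {v}"

lemma self_in_component [simp]: "v \<in> component E v"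
  by (simp add: component_def)

lemma component_step: "a \<in> component E v \<Longrightarrow> {a, b} \<in> E \<Longrightarrow> b \<in> component E v"
  unfolding component_def by (auto intro: rtrancl_into_rtrancl)

lemma component_induct [consumes 1, case_names self step]:
  assumes "w \<in> component E v" "P v"
    and "\<And>a b. a \<in> component E v \<Longrightarrow> P a \<Longrightarrow> {a, b} \<in> E \<Longrightarrow> P b"
  shows "P w"
proof -
  have "(v, w) \<in> {(a, b). {a, b} \<in> E}\<^sup>*" using assms(1) by (simp add: component_def)
  then show ?thesis
  proof (induction rule: rtrancl_induct)
    case base show ?case by (rule assms(2))
  next
    case (step a b)
    then show ?case using assms(3)[of a b] by (simp add: component_def)
  qed
qed

lemma component_eq:
  assumes "w \<in> component E v"
  shows "component E w = component E v"
proof -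
  have "sym ({(a, b). {a, b} \<in> E}\<^sup>*)"
    by (intro sym_rtrancl symI) (simp add: insert_commute)
  then have "v \<in> component E w"
    using assms unfolding component_def by (auto dest: symD)
  then show ?thesis using assms unfolding component_def by auto
qed

lemma component_commute: "w \<in> component E v \<longleftrightarrow> v \<in> component E w"
  using component_eq self_in_component by metis

lemma component_mono:
  assumes "A \<subseteq> B"
  shows "component A v \<subseteq> component B v"
proof
  fix w assume "w \<in> component A v"
  then show "w \<in> component B v"
  proof (induction rule: component_induct)
    case (step a b)
    then show ?case using assms component_step[of a B v b] by blast
  qed simp
qed

lemma component_edge: "{a, b} \<in> E \<Longrightarrow> component E a = component E b"
  by (metis component_eq component_step self_in_component)

lemma component_closed:
  assumes "edge_set E" "e \<in> E" "w \<in> e" "w \<in> component E v"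
  shows "e \<subseteq> component E v"
  using edge_at_vertexE[OF assms(1-3)] assms(2,4) component_step
  by (metis empty_subsetI insert_subset)

lemma finite_component:
  assumes "edge_set E"
  shows "finite (component E v)"
proof -
  have "w \<in> insert v (\<Union>E)" if "w \<in> component E v" for w
    using that by (induction rule: component_induct) auto
  then show ?thesis
    using finite_Union_edge_set[OF assms] by (meson finite_insert finite_subset subsetI)
qed

lemma card_component_le:
  assumes "edge_set E"
  shows "card (component E v) \<le> Suc (card {e \<in> E. e \<subseteq> component E v})"
proof -
  let ?K = "component E v"
  define \<A> where "\<A> = {A. v \<in> A \<and> A \<subseteq> ?K \<and> card A \<le> Suc (card {e \<in> E. e \<subseteq> A})}"
  have finite_K: "finite ?K" using assms by (rule finite_component)
  have "\<A> \<subseteq> Pow ?K" by (auto simp: \<A>_def)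
  then have "finite \<A>" using finite_K by (meson finite_Pow_iff finite_subset)
  moreover have "{v} \<in> \<A>" by (simp add: \<A>_def)
  ultimately obtain A where A_admissible: "A \<in> \<A>" and maximal: "\<And>B. B \<in> \<A> \<Longrightarrow> A \<subseteq> B \<Longrightarrow> A = B"
    using finite_has_maximal[of \<A>] by blast
  have finite_A: "finite A" using A_admissible finite_K finite_subset by (auto simp: \<A>_def)
  have "w \<in> A" if "w \<in> ?K" for w
    using that
  proof (induction rule: component_induct)
    case self then show ?case using A_admissible by (simp add: \<A>_def)
  next
    case (step a b)
    show ?case
    proof (rule ccontr)
      assume "b \<notin> A"
      have "insert {a, b} {e \<in> E. e \<subseteq> A} \<subseteq> {e \<in> E. e \<subseteq> insert b A}" using step by auto
      then have "card (insert {a, b} {e \<in> E. e \<subseteq> A}) \<le> card {e \<in> E. e \<subseteq> insert b A}"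
        using assms by (intro card_mono) (auto simp: edge_set_def)
      then have "insert b A \<in> \<A>"
        using A_admissible \<open>b \<notin> A\<close> finite_A assms component_step[OF step.hyps(1,2)]
        by (auto simp: \<A>_def edge_set_def)
      then show False using maximal[of "insert b A"] \<open>b \<notin> A\<close> by blast
    qed
  qed
  then have "A = ?K" using A_admissible by (auto simp: \<A>_def)
  then show ?thesis using A_admissible by (simp add: \<A>_def)
qed

lemma card_component_ends_le_2:
  assumes edge_set_E: "edge_set E" and degree_le_2: "\<And>v. card (incident E v) \<le> 2"
  shows "card {v \<in> component E x. card (incident E v) \<le> 1} \<le> 2"
proof -
  let ?K = "component E x" and ?ends = "{v \<in> component E x. card (incident E v) \<le> 1}"
  let ?B = "{e \<in> E. e \<subseteq> ?K}"
  have finite_K: "finite ?K" using edge_set_E by (rule finite_component)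
  have "incident ?B v = incident E v" if "v \<in> ?K" for v
    using component_closed[OF edge_set_E _ _ that] by auto
  then have "(\<Sum>v\<in>?K. card (incident E v)) = (\<Sum>v\<in>?K. card (incident ?B v))"
    by simp
  also have "\<dots> = 2 * card ?B"
    using edge_set_E finite_K by (intro sum_card_incident) (auto intro: edge_set_subset)
  finally have degree_sum: "(\<Sum>v\<in>?K. card (incident E v)) = 2 * card ?B" .
  have "card ?ends = (\<Sum>v\<in>?K. if card (incident E v) \<le> 1 then 1 else 0)"
    using finite_K by (simp add: sum.If_cases Int_def)
  then have "2 * card ?B + card ?ends
      = (\<Sum>v\<in>?K. card (incident E v) + (if card (incident E v) \<le> 1 then 1 else 0))"
    using degree_sum by (simp add: sum.distrib)
  also have "\<dots> \<le> (\<Sum>v\<in>?K. 2)"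
    using degree_le_2 by (intro sum_mono) auto
  finally show ?thesis using card_component_le[OF edge_set_E, of x] by simp
qed

section \<open>Sparse edge sets\<close>

definition sparse :: "nat \<Rightarrow> 'a set set \<Rightarrow> bool" where
  "sparse L E \<longleftrightarrow> (\<forall>C\<subseteq>E. finite C \<and> C \<noteq> {} \<and> card C \<le> L \<longrightarrow> card C < card (\<Union>C))"

lemma sparseD:
  "sparse L E \<Longrightarrow> C \<subseteq> E \<Longrightarrow> finite C \<Longrightarrow> C \<noteq> {} \<Longrightarrow> card C \<le> L \<Longrightarrow> card C < card (\<Union>C)"
  by (simp add: sparse_def)

lemma sparse_antimono: "sparse M E \<Longrightarrow> A \<subseteq> E \<Longrightarrow> L \<le> M \<Longrightarrow> sparse L A"
  by (simp add: sparse_def)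

lemma sparse_singleton: "card e = 2 \<Longrightarrow> sparse L {e}"
  unfolding sparse_def by (auto simp: subset_singleton_iff)

lemma sparse_Un:
  assumes sparse_A: "sparse L A" and sparse_B: "sparse L B" and meet_subset: "\<Union>A \<inter> \<Union>B \<subseteq> {x}"
  shows "sparse L (A \<union> B)"
  unfolding sparse_def
proof (intro allI impI, elim conjE)
  fix C assume C_small: "C \<subseteq> A \<union> B" "finite C" "C \<noteq> {}" "card C \<le> L"
  let ?CA = "C \<inter> A" and ?CB = "C - A"
  have card_parts: "card ?CA \<le> L" "card ?CB \<le> L" "card C = card ?CA + card ?CB"
    using C_small card_mono[of C ?CA] card_mono[of C ?CB] card_Un_disjoint[of ?CA ?CB]
    by (auto simp: Int_Diff_Un Int_Diff_disjoint)
  show "card C < card (\<Union>C)"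
  proof (cases "?CA = {} \<or> ?CB = {}")
    case True
    then have "C \<subseteq> A \<or> C \<subseteq> B" using C_small(1) by blast
    then show ?thesis using sparseD[OF sparse_A] sparseD[OF sparse_B] C_small by blast
  next
    case False
    then have parts_less: "card ?CA < card (\<Union>?CA)" "card ?CB < card (\<Union>?CB)"
      using sparseD[OF sparse_A, of ?CA] sparseD[OF sparse_B, of ?CB] C_small card_parts by auto
    then have "finite (\<Union>?CA)" "finite (\<Union>?CB)" by (auto intro: card_ge_0_finite)
    then have "card (\<Union>?CA) + card (\<Union>?CB) = card (\<Union>?CA \<union> \<Union>?CB) + card (\<Union>?CA \<inter> \<Union>?CB)"
      by (rule card_Un_Int)
    also have "\<Union>?CA \<union> \<Union>?CB = \<Union>C" by blast
    finally have "card (\<Union>?CA) + card (\<Union>?CB) = card (\<Union>C) + card (\<Union>?CA \<inter> \<Union>?CB)" .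
    moreover have "\<Union>?CA \<inter> \<Union>?CB \<subseteq> {x}" using meet_subset C_small(1) by blast
    then have "card (\<Union>?CA \<inter> \<Union>?CB) \<le> 1" using card_mono[of "{x}"] by fastforce
    ultimately show ?thesis using parts_less card_parts(3) by linarith
  qed
qed

lemma sparse_Un_UN:
  assumes "finite I" "sparse L B" "\<And>i. i \<in> I \<Longrightarrow> sparse L (A i)"
    and "\<And>i. i \<in> I \<Longrightarrow> \<Union>(A i) \<inter> \<Union>B \<subseteq> {x i}"
    and "\<And>i j. i \<in> I \<Longrightarrow> j \<in> I \<Longrightarrow> i \<noteq> j \<Longrightarrow> \<Union>(A i) \<inter> \<Union>(A j) = {}"
  shows "sparse L (B \<union> (\<Union>i\<in>I. A i))"
  using assms
proof (induction I)
  case empty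
  then show ?case by simp
next
  case (insert i I)
  have meet_subset: "\<Union>(A i) \<inter> \<Union>(B \<union> (\<Union>j\<in>I. A j)) \<subseteq> {x i}"
    using insert.prems(3,4)[of i] insert.hyps(2) by fastforce
  have sparse_rest: "sparse L (B \<union> (\<Union>j\<in>I. A j))" using insert by auto
  have "sparse L (A i \<union> (B \<union> (\<Union>j\<in>I. A j)))"
    by (rule sparse_Un[OF _ sparse_rest meet_subset]) (simp add: insert.prems(2))
  then show ?case by (simp add: Un_left_commute)
qed

lemma sparse_image:
  assumes "inj_on f (\<Union>E)" "sparse L E"
  shows "sparse L ((`) f ` E)"
  unfolding sparse_def
proof (intro allI impI, elim conjE)
  fix D assume D_small: "D \<subseteq> (`) f ` E" "finite D" "D \<noteq> {}" "card D \<le> L"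
  then obtain C where C_preimage: "C \<subseteq> E" "inj_on ((`) f) C" "D = (`) f ` C"
    by (auto simp: subset_image_inj)
  then have "card C = card D" "finite C"
    using D_small(2) by (auto simp: card_image dest: finite_imageD)
  then have "card D < card (\<Union>C)"
    using sparseD[OF assms(2) C_preimage(1)] C_preimage(3) D_small by auto
  moreover have "inj_on f (\<Union>C)" using assms(1) C_preimage(1) by (meson Union_mono inj_on_subset)
  then have "card (\<Union>C) = card (f ` \<Union>C)" by (simp add: card_image)
  moreover have "f ` \<Union>C = \<Union>D" using C_preimage(3) by blast
  ultimately show "card D < card (\<Union>D)" by simp
qed

lemma longest_distinct_list:
  assumes "finite A" "P xs" "\<And>ys. P ys \<Longrightarrow> distinct ys \<and> set ys \<subseteq> A"
  obtains ys where "P ys" "\<And>zs. P zs \<Longrightarrow> length zs \<le> length ys"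
proof -
  have "length ys < Suc (card A)" if "P ys" for ys
    using assms(1,3) that by (metis card_mono distinct_card less_Suc_eq_le)
  then show thesis using ex_has_greatest_nat[of P xs length] assms(2) that by blast
qed

lemma is_cycleI:
  assumes "3 \<le> length vs" "distinct vs" "successively (\<lambda>a b. {a, b} \<in> edges G) vs"
    and "{last vs, hd vs} \<in> edges G"
  shows "is_cycle G vs"
proof -
  have "{vs ! i, vs ! (Suc i mod length vs)} \<in> edges G" if "i < length vs" for i
  proof (cases "Suc i = length vs")
    case True
    then have "vs ! i = last vs" "vs ! (Suc i mod length vs) = hd vs"
      using assms(1) by (cases vs; simp add: last_conv_nth flip: True)+
    then show ?thesis using assms(4) by simp
  next
    case False
    then show ?thesis using that successively_nth[OF assms(3)] by simp
  qed
  then show ?thesis using assms(1,2) by (simp add: is_cycle_def)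
qed

text \<open>The end of a longest path has a second neighbour, which must lie on the path.\<close>

lemma min_degree_two_imp_cycle:
  assumes nonempty_edge_set: "edge_set E" "E \<noteq> {}"
    and degree_ge_2: "\<And>v. v \<in> \<Union>E \<Longrightarrow> 2 \<le> card (incident E v)"
  obtains vs where "is_cycle (V, E) vs" "set vs \<subseteq> \<Union>E"
proof -
  define path where "path vs \<longleftrightarrow>
    distinct vs \<and> set vs \<subseteq> \<Union>E \<and> successively (\<lambda>a b. {a, b} \<in> E) vs \<and> vs \<noteq> []" for vs
  obtain v where "v \<in> \<Union>E"
    using nonempty_edge_set
    by (metis Union_empty_conv card.empty edge_set_card ex_in_conv zero_neq_numeral)
  then have "path [v]" by (simp add: path_def)
  then obtain vs where longest_path: "path vs" and longest: "\<And>ws. path ws \<Longrightarrow> length ws \<le> length vs"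
    using longest_distinct_list[of "\<Union>E" path "[v]"] finite_Union_edge_set[OF nonempty_edge_set(1)]
    unfolding path_def by metis
  obtain h t where vs_Cons: "vs = h # t" using longest_path by (cases vs) (auto simp: path_def)
  have on_path: "u \<in> set t" if "{h, u} \<in> E" for u
  proof (rule ccontr)
    assume "u \<notin> set t"
    then have "path (u # vs)"
      using that longest_path edge_set_neq[OF nonempty_edge_set(1) that]
      by (auto simp: path_def vs_Cons insert_commute)
    then show False using longest by fastforce
  qed
  have "card {{h, hd t}} < card (incident E h)"
    using longest_path degree_ge_2[of h] by (auto simp: path_def vs_Cons)
  then have "\<not> incident E h \<subseteq> {{h, hd t}}"
    by (metis card_mono finite.emptyI finite_insert linorder_not_less)
  then obtain e where "e \<in> E" "h \<in> e" "e \<noteq> {h, hd t}" by (force simp del: insert_iff)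
  then obtain u where u_second_neighbour: "{h, u} \<in> E" "u \<noteq> hd t"
    using edge_at_vertexE[OF nonempty_edge_set(1)] by metis
  obtain as bs where t_split: "t = as @ u # bs"
    using on_path[OF u_second_neighbour(1)] by (meson split_list)
  have "as \<noteq> []" using u_second_neighbour(2) t_split by auto
  then have "is_cycle (V, E) (h # as @ [u])"
    using longest_path u_second_neighbour(1) by (intro is_cycleI)
      (auto simp: path_def vs_Cons t_split successively_Cons successively_append_iff
        insert_commute Suc_le_eq)
  moreover have "set (h # as @ [u]) \<subseteq> \<Union>E"
    using longest_path by (auto simp: path_def vs_Cons t_split)
  ultimately show thesis by (rule that)
qed

lemma card_less_card_Union_pendant:
  assumes edge_set_C: "edge_set C" and pendant_edge: "e \<in> C" "v \<in> e" "card (incident C v) \<le> 1"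
    and rest_less: "C - {e} \<noteq> {} \<Longrightarrow> card (C - {e}) < card (\<Union>(C - {e}))"
  shows "card C < card (\<Union>C)"
proof (cases "C = {e}")
  case True
  then show ?thesis using edge_set_card[OF edge_set_C pendant_edge(1)] by simp
next
  case False
  have "f = e" if "f \<in> C" "v \<in> f" for f
    using that pendant_edge card_le_Suc0_iff_eq[OF finite_incident[OF edge_set_C, of v]] by simp
  then have "\<Union>(C - {e}) \<subset> \<Union>C" using pendant_edge(1,2) by blast
  then have "card (\<Union>(C - {e})) < card (\<Union>C)"
    using finite_Union_edge_set[OF edge_set_C] by (simp add: psubset_card_mono)
  moreover have "card (C - {e}) < card (\<Union>(C - {e}))" using rest_less False pendant_edge(1) by blast
  moreover have "card C = Suc (card (C - {e}))"
    using pendant_edge(1) edge_set_C unfolding edge_set_def by (metis card.remove)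
  ultimately show ?thesis by linarith
qed

lemma sparse_if_no_short_cycle:
  assumes card_edge: "\<And>e. e \<in> E \<Longrightarrow> card e = 2"
    and cycle_length: "\<And>vs. is_cycle (V, E) vs \<Longrightarrow> L < length vs"
  shows "sparse L E"
proof -
  have "card C < card (\<Union>C)" if "finite C" "C \<subseteq> E" "C \<noteq> {}" "card C \<le> L" for C
    using that
  proof (induction "card C" arbitrary: C rule: less_induct)
    case less
    have edge_set_C: "edge_set C" using less.prems card_edge by (auto simp: edge_set_def)
    show ?case
    proof (cases "\<forall>v\<in>\<Union>C. 2 \<le> card (incident C v)")
      case True
      then obtain vs where cycle: "is_cycle (V, C) vs" "set vs \<subseteq> \<Union>C"
        using min_degree_two_imp_cycle[OF edge_set_C less.prems(3)] by metis
      then have "is_cycle (V, E) vs" using less.prems(2) by (auto simp: is_cycle_def)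
      then have "L < card (set vs)"
        using cycle_length cycle(1) by (simp add: is_cycle_def distinct_card)
      also have "\<dots> \<le> card (\<Union>C)"
        using finite_Union_edge_set[OF edge_set_C] cycle(2) by (rule card_mono)
      finally show ?thesis using less.prems(4) by linarith
    next
      case False
      then obtain v e where pendant_edge: "e \<in> C" "v \<in> e" "card (incident C v) \<le> 1" by fastforce
      have "card (C - {e}) < card C" using less.prems(1) pendant_edge(1) by (rule card_Diff1_less)
      then have "card (C - {e}) < card (\<Union>(C - {e}))" if "C - {e} \<noteq> {}"
        using that less.prems by (intro less.hyps) auto
      then show ?thesis by (rule card_less_card_Union_pendant[OF edge_set_C pendant_edge])
    qed
  qed
  then show ?thesis unfolding sparse_def by blast
qed

section \<open>Vizing's theorem\<close>

definition edge_colouring :: "'a set set \<Rightarrow> 'c set \<Rightarrow> ('a set \<Rightarrow> 'c) \<Rightarrow> bool" where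
  "edge_colouring E C c \<longleftrightarrow> c ` E \<subseteq> C \<and> proper_colouring E c"

lemma edge_colouring_subset: "edge_colouring E C c \<Longrightarrow> A \<subseteq> E \<Longrightarrow> edge_colouring A C c"
  unfolding edge_colouring_def by (metis image_mono order_trans proper_colouring_subset)

lemma free_colour_exists:
  assumes "edge_set E" "card (incident E v) < card C" and "A \<subseteq> E"
  obtains i where "i \<in> C" "i \<notin> colours_at A c v"
proof -
  have edge_set_A: "edge_set A" using assms(1,3) by (rule edge_set_subset)
  then have "card (colours_at A c v) \<le> card (incident A v)"
    unfolding colours_at_def by (intro card_image_le finite_incident)
  also have "\<dots> < card C" using card_incident_mono[OF assms(1,3), of v] assms(2) by linarith
  finally have "\<not> C \<subseteq> colours_at A c v"
    using card_mono[OF finite_colours_at[OF edge_set_A], of C c v] by linarith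
  then show thesis using that by blast
qed

lemma edge_colouring_insert:
  assumes colouring: "edge_colouring E C c"
    and colour_free: "i \<in> C" "i \<notin> colours_at E c x" "i \<notin> colours_at E c y"
  shows "edge_colouring (insert {x, y} E) C (c({x, y} := i))"
  unfolding edge_colouring_def
proof
  show "proper_colouring (insert {x, y} E) (c({x, y} := i))"
  proof (rule proper_colouringI)
    have "c e \<noteq> i" if "e \<in> E" "v \<in> e" "v \<in> {x, y}" for e v
      using colour_free(2,3) that by (auto dest: in_colours_atI[of e E v c])
    then show "e = f" if "e \<in> insert {x, y} E" "f \<in> insert {x, y} E" "v \<in> e" "v \<in> f"
      "(c({x, y} := i)) e = (c({x, y} := i)) f" for e f v
      using that colouring proper_colouringD[of E c e f v]
      by (auto simp: edge_colouring_def split: if_splits)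
  qed
qed (use colouring colour_free(1) in \<open>auto simp: edge_colouring_def\<close>)

text \<open>A fan is based at the uncoloured edge \<^term>\<open>{x, hd ys}\<close>: the colour of the edge from \<^term>\<open>x\<close>
  to each later vertex is free at its predecessor, so that the colours can be shifted towards
  the base.\<close>

definition fan :: "'a set set \<Rightarrow> ('a set \<Rightarrow> 'c) \<Rightarrow> 'a \<Rightarrow> 'a list \<Rightarrow> bool" where
  "fan E c x ys \<longleftrightarrow> ys \<noteq> [] \<and> distinct ys \<and> (\<forall>z\<in>set ys. {x, z} \<in> E) \<and>
     successively (\<lambda>a b. c {x, b} \<notin> colours_at (E - {{x, hd ys}}) c a) ys"

lemma fan_prefix: "fan E c x (ys @ zs) \<Longrightarrow> ys \<noteq> [] \<Longrightarrow> fan E c x ys"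
  by (auto simp: fan_def successively_append_iff)

lemma fan_rotate_edge_colouring:
  assumes base_edge: "{x, y} \<in> E" and second_edge: "{x, z} \<in> E - {{x, y}}"
    and colouring: "edge_colouring (E - {{x, y}}) C c"
    and colour_free: "c {x, z} \<notin> colours_at (E - {{x, y}}) c y"
  shows "edge_colouring (E - {{x, z}}) C (c({x, y} := c {x, z}))"
proof -
  let ?D = "E - {{x, y}}"
  have proper: "proper_colouring ?D c" using colouring by (simp add: edge_colouring_def)
  have "edge_colouring (?D - {{x, z}}) C c"
    using colouring by (auto intro: edge_colouring_subset)
  moreover have "c {x, z} \<in> C" using colouring second_edge by (auto simp: edge_colouring_def)
  moreover have "c {x, z} \<notin> colours_at (?D - {{x, z}}) c x"
    using proper_colouringD[OF proper second_edge, of _ x] unfolding colours_at_def by fastforce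
  moreover have "c {x, z} \<notin> colours_at (?D - {{x, z}}) c y"
    using colour_free colours_at_mono[of "?D - {{x, z}}" ?D c y] by blast
  ultimately have "edge_colouring (insert {x, y} (?D - {{x, z}})) C (c({x, y} := c {x, z}))"
    by (rule edge_colouring_insert)
  moreover have "insert {x, y} (?D - {{x, z}}) = E - {{x, z}}" using base_edge second_edge by auto
  ultimately show ?thesis by simp
qed

lemma colours_at_fan_rotate_subset:
  assumes second_edge: "{x, z} \<in> E - {{x, y}}" and "v \<noteq> y"
  shows "colours_at (E - {{x, z}}) (c({x, y} := c {x, z})) v \<subseteq> colours_at (E - {{x, y}}) c v"
proof
  let ?c = "c({x, y} := c {x, z})"
  fix k assume "k \<in> colours_at (E - {{x, z}}) ?c v"
  then obtain e where e_coloured: "e \<in> E - {{x, z}}" "v \<in> e" "k = ?c e"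
    unfolding in_colours_at_iff by blast
  show "k \<in> colours_at (E - {{x, y}}) c v"
  proof (cases "e = {x, y}")
    case True
    then show ?thesis using e_coloured(2,3) \<open>v \<noteq> y\<close> in_colours_atI[OF second_edge, of v c] by simp
  next
    case False
    then show ?thesis using e_coloured in_colours_atI[of e "E - {{x, y}}" v c] by simp
  qed
qed

lemma fan_rotate:
  assumes is_fan: "fan E c x (y # z # zs)" and colouring: "edge_colouring (E - {{x, y}}) C c"
  shows "{x, z} \<in> E - {{x, y}}" "edge_colouring (E - {{x, z}}) C (c({x, y} := c {x, z}))"
    "fan E (c({x, y} := c {x, z})) x (z # zs)"
proof -
  let ?c = "c({x, y} := c {x, z})"
  have distinct: "distinct (y # z # zs)" and edges: "{x, y} \<in> E" "\<forall>v\<in>set (z # zs). {x, v} \<in> E"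
    and colour_free: "c {x, z} \<notin> colours_at (E - {{x, y}}) c y"
    and shifts: "successively (\<lambda>a b. c {x, b} \<notin> colours_at (E - {{x, y}}) c a) (z # zs)"
    using is_fan by (simp_all add: fan_def)
  show second_edge: "{x, z} \<in> E - {{x, y}}" using distinct edges(2) by (auto simp: doubleton_eq_iff)
  show "edge_colouring (E - {{x, z}}) C ?c"
    using edges(1) second_edge colouring colour_free by (rule fan_rotate_edge_colouring)
  have "successively (\<lambda>a b. ?c {x, b} \<notin> colours_at (E - {{x, z}}) ?c a) (z # zs)"
  proof (rule successively_mono[OF shifts])
    fix a b
    assume "a \<in> set (z # zs)" "b \<in> set (z # zs)" "c {x, b} \<notin> colours_at (E - {{x, y}}) c a"
    moreover from this have "a \<noteq> y" "b \<noteq> y" using distinct by auto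
    ultimately show "?c {x, b} \<notin> colours_at (E - {{x, z}}) ?c a"
      using colours_at_fan_rotate_subset[OF second_edge, of a c] by (auto simp: doubleton_eq_iff)
  qed
  then show "fan E ?c x (z # zs)" using distinct edges(2) by (simp add: fan_def)
qed

lemma fan_shift:
  assumes edge_set_E: "edge_set E"
  shows "fan E c x ys \<Longrightarrow> edge_colouring (E - {{x, hd ys}}) C c \<Longrightarrow> i \<in> C \<Longrightarrow>
    i \<notin> colours_at (E - {{x, hd ys}}) c x \<Longrightarrow> i \<notin> colours_at (E - {{x, hd ys}}) c (last ys) \<Longrightarrow>
    \<exists>c'. edge_colouring E C c'"
proof (induction ys arbitrary: c)
  case Nil
  then show ?case by (simp add: fan_def)
next
  case (Cons y ys)
  have base_edge: "{x, y} \<in> E" using Cons.prems(1) by (simp add: fan_def)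
  have colouring: "edge_colouring (E - {{x, y}}) C c" using Cons.prems(2) by simp
  show ?case
  proof (cases ys)
    case Nil
    then have "edge_colouring (insert {x, y} (E - {{x, y}})) C (c({x, y} := i))"
      using Cons.prems by (intro edge_colouring_insert) auto
    then show ?thesis using base_edge by (auto simp: insert_absorb)
  next
    case (Cons z zs)
    let ?c = "c({x, y} := c {x, z})"
    note rotate = fan_rotate[OF Cons.prems(1)[unfolded Cons] colouring]
    have "x \<noteq> y" using edge_set_E base_edge by (rule edge_set_neq)
    moreover have "last ys \<noteq> y"
      using Cons.prems(1) last_in_set[of ys] Cons by (auto simp: fan_def)
    ultimately have "i \<notin> colours_at (E - {{x, z}}) ?c x"
      "i \<notin> colours_at (E - {{x, z}}) ?c (last ys)"
      using colours_at_fan_rotate_subset[OF rotate(1), of x c]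
        colours_at_fan_rotate_subset[OF rotate(1), of "last ys" c] Cons.prems(4,5) Cons by auto
    then show ?thesis
      using Cons.IH[of ?c] rotate(2,3) Cons.prems(3) unfolding Cons list.sel(1) by blast
  qed
qed

definition kempe_swap :: "'c \<Rightarrow> 'c \<Rightarrow> 'a set \<Rightarrow> ('a set \<Rightarrow> 'c) \<Rightarrow> 'a set \<Rightarrow> 'c" where
  "kempe_swap i j K c e = (if e \<inter> K = {} then c e else transpose i j (c e))"

context
  fixes E :: "'a set set" and c :: "'a set \<Rightarrow> 'c" and i j :: 'c and K :: "'a set"
  assumes closed: "\<forall>e\<in>E. c e \<in> {i, j} \<longrightarrow> e \<inter> K \<noteq> {} \<longrightarrow> e \<subseteq> K"
begin

lemma kempe_swap_at:
  assumes "e \<in> E" "v \<in> e"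
  shows "kempe_swap i j K c e = (if v \<in> K then transpose i j (c e) else c e)"
proof (cases "c e \<in> {i, j}")
  case True
  then show ?thesis using closed assms by (auto simp: kempe_swap_def)
next
  case False
  then show ?thesis by (auto simp: kempe_swap_def transpose_def)
qed

lemma colours_at_kempe_swap:
  "colours_at E (kempe_swap i j K c) v =
     (if v \<in> K then transpose i j ` colours_at E c v else colours_at E c v)"
proof -
  have "kempe_swap i j K c e = (if v \<in> K then transpose i j (c e) else c e)"
    if "e \<in> incident E v" for e
    using that by (intro kempe_swap_at) simp_all
  then have "kempe_swap i j K c ` incident E v
      = (\<lambda>e. if v \<in> K then transpose i j (c e) else c e) ` incident E v"
    by (intro image_cong refl)
  then show ?thesis by (simp add: colours_at_def image_image)
qed

lemma edge_colouring_kempe_swap: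
  assumes "edge_colouring E C c" "i \<in> C" "j \<in> C"
  shows "edge_colouring E C (kempe_swap i j K c)"
  unfolding edge_colouring_def
proof
  show "kempe_swap i j K c ` E \<subseteq> C"
    using assms by (auto simp: edge_colouring_def kempe_swap_def transpose_def)
  show "proper_colouring E (kempe_swap i j K c)"
  proof (rule proper_colouringI)
    fix e f v
    assume same_colour: "e \<in> E" "f \<in> E" "v \<in> e" "v \<in> f"
      "kempe_swap i j K c e = kempe_swap i j K c f"
    then have "c e = c f" by (auto simp: kempe_swap_at[of _ v] transpose_eq_iff split: if_splits)
    then show "e = f"
      using assms(1) same_colour by (auto simp: edge_colouring_def dest: proper_colouringD)
  qed
qed

end

lemma fan_kempe_swap:
  assumes edge_set_E: "edge_set E" and is_fan: "fan E c x zs"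
    and D_eq: "D = E - {{x, hd zs}}" and colouring: "edge_colouring D C c"
    and i_free_x: "i \<in> C" "i \<notin> colours_at D c x"
    and j_free_last: "j \<in> C" "j \<notin> colours_at D c (last zs)"
    and kempe_component: "K = component {e \<in> D. c e \<in> {i, j}} (last zs)" "x \<notin> K"
    and guard: "successively (\<lambda>a b. c {x, b} = j \<longrightarrow> a \<notin> K) zs"
  shows "\<exists>c'. edge_colouring E C c'"
proof -
  let ?c = "kempe_swap i j K c"
  have "edge_set {e \<in> D. c e \<in> {i, j}}" using edge_set_E D_eq by (auto intro: edge_set_subset)
  from component_closed[OF this]
  have closed: "\<forall>e\<in>D. c e \<in> {i, j} \<longrightarrow> e \<inter> K \<noteq> {} \<longrightarrow> e \<subseteq> K"
    unfolding kempe_component(1) by blast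
  have "last zs \<in> K" unfolding kempe_component(1) by simp
  note colours_swapped = colours_at_kempe_swap[of D c i j K, OF closed]
  have "?c {x, b} \<notin> colours_at D ?c a"
    if consecutive: "Suc k < length zs" "a = zs ! k" "b = zs ! Suc k" for a b k
  proof -
    have "b \<noteq> hd zs"
      using consecutive is_fan nth_eq_iff_index_eq[of zs "Suc k" 0]
      by (auto simp: fan_def hd_conv_nth)
    then have edge_xb: "{x, b} \<in> D"
      using is_fan consecutive D_eq by (auto simp: fan_def doubleton_eq_iff)
    then have "c {x, b} \<noteq> i" using i_free_x(2) in_colours_atI[of "{x, b}" D x c] by auto
    moreover have "c {x, b} = j \<longrightarrow> a \<notin> K" using successively_nth[OF guard] consecutive by simp
    moreover have "c {x, b} \<notin> colours_at D c a"
      using is_fan consecutive D_eq by (auto simp: fan_def dest: successively_nth)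
    ultimately have "c {x, b} \<notin> colours_at D ?c a"
      by (auto simp: colours_swapped transpose_def split: if_splits)
    moreover have "?c {x, b} = c {x, b}"
      using kempe_swap_at[OF closed edge_xb, of x] kempe_component(2) by simp
    ultimately show ?thesis by simp
  qed
  then have "fan E ?c x zs"
    using is_fan D_eq by (auto simp: fan_def successively_conv_nth)
  moreover have "edge_colouring D C ?c"
    using closed colouring i_free_x(1) j_free_last(1) by (rule edge_colouring_kempe_swap)
  moreover have "i \<notin> colours_at D ?c x"
    using i_free_x(2) kempe_component(2) by (simp add: colours_swapped)
  moreover have "i \<notin> colours_at D ?c (last zs)"
    using j_free_last(2) \<open>last zs \<in> K\<close>
    by (auto simp: colours_swapped transpose_def split: if_splits)
  ultimately show ?thesis
    using fan_shift[OF edge_set_E, of ?c x zs C i] i_free_x(1) unfolding D_eq[symmetric] by blast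
qed

lemma fan_edge_colour_unique:
  assumes is_fan: "fan E c x (cs @ p # w # bs)"
    and proper: "proper_colouring (E - {{x, hd (cs @ p # w # bs)}}) c"
    and kth_colour: "Suc k < length (cs @ p # w # bs)" "c {x, (cs @ p # w # bs) ! Suc k} = c {x, w}"
  shows "k = length cs"
proof -
  let ?ys = "cs @ p # w # bs"
  have distinct: "distinct ?ys" using is_fan by (simp add: fan_def)
  have fan_edge: "{x, ?ys ! Suc m} \<in> E - {{x, hd ?ys}}" if "Suc m < length ?ys" for m
  proof -
    have "?ys ! Suc m \<noteq> hd ?ys"
      using distinct that nth_eq_iff_index_eq[of ?ys "Suc m" 0] by (auto simp: hd_conv_nth)
    then show ?thesis using is_fan nth_mem[OF that] by (auto simp: fan_def doubleton_eq_iff)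
  qed
  have w_nth: "w = ?ys ! Suc (length cs)" by (simp add: nth_append)
  have "{x, w} \<in> E - {{x, hd ?ys}}" using fan_edge[of "length cs"] w_nth by simp
  then have "{x, ?ys ! Suc k} = {x, w}"
    using proper_colouringD[OF proper fan_edge[OF kth_colour(1)]] kth_colour(2) by blast
  then have "?ys ! Suc k = ?ys ! Suc (length cs)"
    unfolding w_nth[symmetric] by (auto simp: doubleton_eq_iff)
  then show ?thesis
    using distinct kth_colour(1) nth_eq_iff_index_eq[of ?ys "Suc k" "Suc (length cs)"] by simp
qed

lemma fan_colour_occurrences:
  assumes "fan E c x (cs @ p # w # bs)"
    and "proper_colouring (E - {{x, hd (cs @ p # w # bs)}}) c"
  shows "successively (\<lambda>a b. c {x, b} \<noteq> c {x, w}) (cs @ [p])"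
    "successively (\<lambda>a b. c {x, b} = c {x, w} \<longrightarrow> a = p) (cs @ p # w # bs)"
proof -
  let ?ys = "cs @ p # w # bs"
  note unique = fan_edge_colour_unique[OF assms]
  have "c {x, (cs @ [p]) ! Suc k} \<noteq> c {x, w}" if "Suc k < length (cs @ [p])" for k
    using unique[of k] that by (auto simp: nth_append)
  then show "successively (\<lambda>a b. c {x, b} \<noteq> c {x, w}) (cs @ [p])"
    by (simp add: successively_conv_nth)
  have "?ys ! k = p" if "Suc k < length ?ys" "c {x, ?ys ! Suc k} = c {x, w}" for k
    unfolding unique[OF that] nth_append_length ..
  then show "successively (\<lambda>a b. c {x, b} = c {x, w} \<longrightarrow> a = p) ?ys"
    unfolding successively_conv_nth by blast
qed

lemma kempe_ends_separated:
  assumes edge_set_E: "edge_set E" and proper: "proper_colouring E c"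
    and S_eq: "S = {e \<in> E. c e \<in> {i, j}}"
    and distinct: "x \<noteq> y" "x \<noteq> z" "y \<noteq> z"
    and colour_free: "\<And>v. v \<in> {x, y, z} \<Longrightarrow> i \<notin> colours_at E c v \<or> j \<notin> colours_at E c v"
  shows "y \<notin> component S x \<or> z \<notin> component S x"
proof (rule ccontr)
  assume "\<not> ?thesis"
  then have connected: "{x, y, z} \<subseteq> component S x" by simp
  have edge_set_S: "edge_set S" using edge_set_E S_eq by (auto intro: edge_set_subset)
  have degree: "card (incident S v) = card ({i, j} \<inter> colours_at E c v)" for v
    unfolding S_eq using proper by (rule card_incident_colour_class)
  have degree_le_2: "card (incident S v) \<le> 2" for v
  proof -
    have "card (incident S v) \<le> card {i, j}" unfolding degree by (intro card_mono) auto
    also have "\<dots> \<le> 2" by (simp add: card_insert_if)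
    finally show ?thesis .
  qed
  have "card (incident S v) \<le> 1" if "v \<in> {x, y, z}" for v
  proof -
    have "{i, j} \<inter> colours_at E c v \<subseteq> {i} \<or> {i, j} \<inter> colours_at E c v \<subseteq> {j}"
      using colour_free[OF that] by blast
    then show ?thesis
      unfolding degree using card_mono[of "{i}"] card_mono[of "{j}"] by fastforce
  qed
  then have "{x, y, z} \<subseteq> {v \<in> component S x. card (incident S v) \<le> 1}"
    using connected by blast
  then have "card {x, y, z} \<le> card {v \<in> component S x. card (incident S v) \<le> 1}"
    using finite_component[OF edge_set_S, of x] by (intro card_mono) simp_all
  also have "\<dots> \<le> 2" using edge_set_S degree_le_2 by (rule card_component_ends_le_2)
  finally show False using distinct by simp
qed

lemma longest_fan:
  assumes edge_set_E: "edge_set E" and base_edge: "{x, y} \<in> E" and D_eq: "D = E - {{x, y}}"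
    and degree_less: "\<And>v. card (incident E v) < card C" and colouring: "edge_colouring D C c"
    and stuck: "\<nexists>c'. edge_colouring E C c'"
  obtains cs p w bs where "fan E c x (cs @ p # w # bs)" "hd (cs @ p # w # bs) = y"
    "c {x, w} \<in> C" "c {x, w} \<notin> colours_at D c (last (cs @ p # w # bs))"
proof -
  define P where "P ys \<longleftrightarrow> fan E c x ys \<and> hd ys = y" for ys
  have "P [y]" using base_edge by (simp add: P_def fan_def)
  then obtain ys where P_ys: "P ys" and longest: "\<And>zs. P zs \<Longrightarrow> length zs \<le> length ys"
    by (rule longest_distinct_list[of "\<Union>E" P "[y]", OF finite_Union_edge_set[OF edge_set_E]])
      (auto simp: P_def fan_def)
  have is_fan: "fan E c x ys" "hd ys = y"
    using P_ys by (simp_all add: P_def)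
  have shifts: "successively (\<lambda>a b. c {x, b} \<notin> colours_at D c a) ys"
    using is_fan(1) unfolding fan_def is_fan(2) D_eq by blast
  have "edge_set D" "D \<subseteq> E" using edge_set_E D_eq by (auto intro: edge_set_subset)
  then obtain j where j_free_last: "j \<in> C" "j \<notin> colours_at D c (last ys)"
    using free_colour_exists[OF edge_set_E degree_less] by metis
  then have "j \<in> colours_at D c x"
    using fan_shift[OF edge_set_E is_fan(1), of C j] colouring stuck
    unfolding is_fan(2) D_eq[symmetric] by blast
  then obtain w where w_edge: "{x, w} \<in> D" "c {x, w} = j"
    using in_colours_atE[OF \<open>edge_set D\<close>] by metis
  have "w \<in> set ys"
  proof (rule ccontr)
    assume "w \<notin> set ys"
    then have "P (ys @ [w])"
      using is_fan w_edge subsetD[OF \<open>D \<subseteq> E\<close> w_edge(1)] j_free_last(2) shifts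
      by (auto simp: P_def fan_def successively_append_iff simp flip: D_eq)
    then show False using longest by fastforce
  qed
  then obtain as bs where "ys = as @ w # bs" by (meson split_list)
  moreover have "w \<noteq> y" using w_edge(1) D_eq by auto
  ultimately obtain cs p where "ys = cs @ p # w # bs"
    using is_fan(2) by (cases as rule: rev_cases) auto
  then show thesis using that is_fan j_free_last w_edge by auto
qed

text \<open>A colour \<^term>\<open>j\<close> that is free at the end of a longest fan occurs at \<^term>\<open>x\<close>, on the edge to some fan
  vertex \<^term>\<open>w\<close>, and is also free at the predecessor \<^term>\<open>p\<close> of \<^term>\<open>w\<close>. Exchanging \<^term>\<open>j\<close> with a colour
  free at \<^term>\<open>x\<close> on the path from \<^term>\<open>p\<close>, or else on the path from the end of the fan, makes the fan up
  to that vertex shiftable.\<close>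

lemma edge_colouring_extend:
  assumes edge_set_E: "edge_set E" and base_edge: "{x, y} \<in> E"
    and degree_less: "\<And>v. card (incident E v) < card C"
    and colouring: "edge_colouring (E - {{x, y}}) C c"
  shows "\<exists>c'. edge_colouring E C c'"
proof (rule ccontr)
  assume stuck: "\<nexists>c'. edge_colouring E C c'"
  define D where "D = E - {{x, y}}"
  have sub_D: "edge_set D" "D \<subseteq> E" using edge_set_E by (auto simp: D_def intro: edge_set_subset)
  have colouring_D: "edge_colouring D C c" using colouring by (simp add: D_def)
  then have proper: "proper_colouring D c" by (simp add: edge_colouring_def)
  obtain cs p w bs where is_fan: "fan E c x (cs @ p # w # bs)" "hd (cs @ p # w # bs) = y"
    and j_free_last: "c {x, w} \<in> C" "c {x, w} \<notin> colours_at D c (last (cs @ p # w # bs))"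
    using longest_fan[OF edge_set_E base_edge D_def degree_less colouring_D stuck] by metis
  let ?ys = "cs @ p # w # bs" and ?l = "last (cs @ p # w # bs)" and ?j = "c {x, w}"
  have D_eq: "D = E - {{x, hd ?ys}}" using is_fan(2) by (simp add: D_def)
  obtain i where i_free_x: "i \<in> C" "i \<notin> colours_at D c x"
    using free_colour_exists[OF edge_set_E degree_less] sub_D(2) by metis
  let ?S = "{e \<in> D. c e \<in> {i, ?j}}"
  let ?K = "component ?S"
  have j_free_p: "?j \<notin> colours_at D c p"
    using is_fan by (auto simp: fan_def D_def successively_append_iff)
  note occurrences = fan_colour_occurrences[OF is_fan(1) proper[unfolded D_eq]]
  have "x \<noteq> p" "x \<noteq> ?l" "p \<noteq> ?l"
    using is_fan(1) edge_set_neq[OF edge_set_E] last_in_set[of "w # bs"] by (auto simp: fan_def)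
  then consider (prefix) "p \<notin> ?K x" | (whole) "p \<in> ?K x" "?l \<notin> ?K x"
    using kempe_ends_separated[OF sub_D(1) proper refl] i_free_x(2) j_free_last(2) j_free_p by blast
  then show False
  proof cases
    case prefix
    then have "x \<notin> ?K p" using component_commute[of p ?S x] by blast
    moreover have "fan E c x (cs @ [p])" using is_fan(1) fan_prefix[of E c x "cs @ [p]"] by simp
    moreover have "hd (cs @ [p]) = hd ?ys" by (cases cs) auto
    moreover have "successively (\<lambda>a b. c {x, b} = ?j \<longrightarrow> a \<notin> ?K p) (cs @ [p])"
      using occurrences(1) by (rule successively_mono) simp
    ultimately show False
      using fan_kempe_swap[OF edge_set_E, of c x "cs @ [p]" D C i ?j] D_eq colouring_D i_free_x
        j_free_last(1) j_free_p stuck by simp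
  next
    case whole
    then have "x \<notin> ?K ?l" "p \<notin> ?K ?l"
      using component_eq[OF whole(1)] component_commute[of _ ?S ?l] by blast+
    moreover from this have "successively (\<lambda>a b. c {x, b} = ?j \<longrightarrow> a \<notin> ?K ?l) ?ys"
      by (intro successively_mono[OF occurrences(2)]) simp
    ultimately show False
      using fan_kempe_swap[OF edge_set_E is_fan(1) D_eq colouring_D i_free_x j_free_last refl] stuck
      by blast
  qed
qed

theorem Vizing:
  assumes "edge_set E" "\<And>v. card (incident E v) < card C"
  shows "\<exists>c. edge_colouring E C c"
proof -
  have "finite E" using assms(1) by (simp add: edge_set_def)
  then show ?thesis
    using assms
  proof (induction E)
    case empty
    then show ?case by (simp add: edge_colouring_def proper_colouring_def incident_def)
  next
    case (insert e E)
    obtain x y where e_eq: "e = {x, y}"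
      using edge_set_card[OF insert.prems(1), of e] by (auto simp: card_2_iff)
    have "card (incident E v) < card C" for v
      using insert.prems by (meson card_incident_mono le_less_trans subset_insertI)
    moreover have "edge_set E" using insert.prems(1) by (rule edge_set_subset) blast
    ultimately obtain c where "edge_colouring E C c" using insert.IH by blast
    then show ?case
      using edge_colouring_extend[of "insert e E" x y C c] insert.prems insert.hyps(2) e_eq by simp
  qed
qed

section \<open>Regular graphs of large girth\<close>

definition involution_edges :: "('i \<Rightarrow> 'a \<Rightarrow> 'a) \<Rightarrow> 'i set \<Rightarrow> 'a set \<Rightarrow> 'a set set" where
  "involution_edges s I V = {{v, s i v} |i v. i \<in> I \<and> v \<in> V}"

locale free_involutions =
  fixes V :: "'a set" and I :: "'i set" and s :: "'i \<Rightarrow> 'a \<Rightarrow> 'a"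
  assumes finite_V: "finite V" and finite_I: "finite I"
    and closed: "i \<in> I \<Longrightarrow> v \<in> V \<Longrightarrow> s i v \<in> V"
    and involutive: "i \<in> I \<Longrightarrow> v \<in> V \<Longrightarrow> s i (s i v) = v"
    and no_fixpoint: "i \<in> I \<Longrightarrow> v \<in> V \<Longrightarrow> s i v \<noteq> v"
    and separating: "i \<in> I \<Longrightarrow> j \<in> I \<Longrightarrow> v \<in> V \<Longrightarrow> s i v = s j v \<Longrightarrow> i = j"
begin

lemma involution_edge_subset: "e \<in> involution_edges s I V \<Longrightarrow> e \<subseteq> V"
  using closed by (auto simp: involution_edges_def)

lemma edge_set_involution_edges: "edge_set (involution_edges s I V)"
proof -
  have "involution_edges s I V = (\<lambda>(i, v). {v, s i v}) ` (I \<times> V)"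
    by (auto simp: involution_edges_def)
  moreover have "card {v, s i v} = 2" if "i \<in> I" "v \<in> V" for i v
    using no_fixpoint[OF that] by (auto simp: card_2_iff)
  ultimately show ?thesis using finite_V finite_I by (auto simp: edge_set_def)
qed

lemma involution_edgeE:
  assumes "{v, w} \<in> involution_edges s I V"
  obtains i where "i \<in> I" "w = s i v"
proof -
  obtain i p where edge_eq: "{v, w} = {p, s i p}" "i \<in> I" "p \<in> V"
    using assms unfolding involution_edges_def by blast
  then consider "v = p" "w = s i p" | "v = s i p" "w = p" by (auto simp: doubleton_eq_iff)
  then have "w = s i v" using involutive[OF edge_eq(2,3)] by cases simp_all
  then show thesis using that edge_eq(2) by blast
qed

lemma card_incident_involution_edges:
  assumes "v \<in> V"
  shows "card (incident (involution_edges s I V) v) = card I"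
proof -
  have "incident (involution_edges s I V) v = (\<lambda>i. {v, s i v}) ` I"
  proof (intro equalityI subsetI)
    fix e assume "e \<in> incident (involution_edges s I V) v"
    then obtain w where "e = {v, w}" "{v, w} \<in> involution_edges s I V"
      using edge_at_vertexE[OF edge_set_involution_edges] by (metis in_incident_iff)
    then show "e \<in> (\<lambda>i. {v, s i v}) ` I" using involution_edgeE by blast
  qed (use assms in \<open>auto simp: involution_edges_def\<close>)
  moreover have "inj_on (\<lambda>i. {v, s i v}) I"
    using assms separating by (auto intro!: inj_onI simp: doubleton_eq_iff)
  ultimately show ?thesis by (simp add: card_image)
qed

lemma involution_perfect_matching:
  assumes "i \<in> I"
  shows "\<exists>M\<subseteq>involution_edges s I V. disjoint M \<and> \<Union>M = V"
proof (intro exI conjI)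
  let ?M = "(\<lambda>v. {v, s i v}) ` V"
  show "?M \<subseteq> involution_edges s I V" using assms by (auto simp: involution_edges_def)
  show "disjoint ?M"
    using involutive[OF assms] by (intro disjointI) (auto simp: doubleton_eq_iff, metis+)
  show "\<Union>?M = V" using closed[OF assms] by auto
qed

lemma involution_cycle_word:
  assumes cycle: "is_cycle (W, involution_edges s I V) vs"
  obtains w where "\<And>k. w k \<in> I" "\<And>k. w (Suc k) \<noteq> w k"
    "\<And>k. vs ! (Suc k mod length vs) = s (w k) (vs ! (k mod length vs))"
proof -
  let ?p = "\<lambda>k. vs ! (k mod length vs)"
  have length_ge_3: "3 \<le> length vs" and distinct: "distinct vs"
    and adjacent: "\<And>i. i < length vs \<Longrightarrow>
      {vs ! i, vs ! (Suc i mod length vs)} \<in> involution_edges s I V"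
    using cycle by (auto simp: is_cycle_def)
  have "0 < length vs" using length_ge_3 by linarith
  then have step_edge: "{?p k, ?p (Suc k)} \<in> involution_edges s I V" for k
    using adjacent[of "k mod length vs"] by (simp add: mod_Suc_eq)
  then have "\<exists>i\<in>I. ?p (Suc k) = s i (?p k)" for k using involution_edgeE by metis
  then obtain w where word: "\<And>k. w k \<in> I" "\<And>k. ?p (Suc k) = s (w k) (?p k)" by metis
  have "w (Suc k) \<noteq> w k" for k
  proof
    assume "w (Suc k) = w k"
    moreover have "?p k \<in> V" using involution_edge_subset[OF step_edge] by simp
    ultimately have "?p (Suc (Suc k)) = ?p k" using word involutive by metis
    then have "Suc (Suc k) mod length vs = k mod length vs"
      using nth_eq_iff_index_eq[OF distinct] \<open>0 < length vs\<close> by simp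
    then have "length vs dvd Suc (Suc k) - k" by (subst mod_eq_dvd_iff_nat[symmetric]) auto
    then show False using length_ge_3 dvd_imp_le[of "length vs" 2] by simp
  qed
  then show thesis using that word by blast
qed

end

definition reduced_words :: "'i set \<Rightarrow> nat \<Rightarrow> 'i list set" where
  "reduced_words I L = {w. set w \<subseteq> I \<and> length w \<le> L \<and> distinct_adj w}"

definition toggle :: "'i set \<Rightarrow> nat \<Rightarrow> 'i \<Rightarrow> 'i list \<Rightarrow> 'i list" where
  "toggle I L i w =
     (if w \<notin> reduced_words I L then w
      else if w \<noteq> [] \<and> hd w = i then tl w
      else if length w < L then i # w else w)"

lemma Nil_reduced_words [simp]: "[] \<in> reduced_words I L"
  by (simp add: reduced_words_def)

lemma finite_reduced_words: "finite I \<Longrightarrow> finite (reduced_words I L)"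
  by (rule finite_subset[OF _ finite_lists_length_le[of I L]]) (auto simp: reduced_words_def)

lemma toggle_reduced_words:
  assumes "i \<in> I" "w \<in> reduced_words I L"
  shows "toggle I L i w \<in> reduced_words I L"
  using assms by (cases w) (auto simp: toggle_def reduced_words_def distinct_adj_Cons)

lemma toggle_toggle:
  assumes "i \<in> I"
  shows "toggle I L i (toggle I L i w) = w"
proof (cases "w \<in> reduced_words I L")
  case True
  note reduced = toggle_reduced_words[OF assms True]
  consider (del) w' where "w = i # w'" | (add) "w = [] \<or> hd w \<noteq> i" "length w < L"
    | (stay) "w = [] \<or> hd w \<noteq> i" "\<not> length w < L"
    by (cases w) auto
  then show ?thesis
  proof cases
    case del
    then have "toggle I L i w = w'" using True by (simp add: toggle_def)
    moreover have "w' = [] \<or> hd w' \<noteq> i" "length w' < L"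
      using True del by (auto simp: reduced_words_def distinct_adj_Cons)
    ultimately show ?thesis using reduced del by (auto simp: toggle_def)
  next
    case add
    then have "toggle I L i w = i # w" using True by (auto simp: toggle_def)
    then show ?thesis using reduced by (simp add: toggle_def)
  next
    case stay
    then have "toggle I L i w = w" using True by (auto simp: toggle_def)
    then show ?thesis by simp
  qed
qed (simp add: toggle_def)

lemma toggle_permutes:
  assumes "i \<in> I"
  shows "toggle I L i permutes reduced_words I L"
proof (rule bij_imp_permutes)
  show "bij_betw (toggle I L i) (reduced_words I L) (reduced_words I L)"
    by (rule bij_betw_byWitness[where f' = "toggle I L i"])
      (use toggle_reduced_words toggle_toggle assms in auto)
qed (simp add: toggle_def)

lemma toggle_walk:
  assumes start: "f 0 = []" and walk_step: "\<And>k. f (Suc k) = toggle I L (w k) (f k)"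
    and word: "\<And>k. w k \<in> I" "\<And>k. w (Suc k) \<noteq> w k" and "k \<le> L"
  shows "f k \<in> reduced_words I L \<and> length (f k) = k \<and> (0 < k \<longrightarrow> hd (f k) = w (k - 1))"
  using \<open>k \<le> L\<close>
proof (induction k)
  case 0
  then show ?case using start by simp
next
  case (Suc k)
  then have reduced: "f k \<in> reduced_words I L" and length_eq: "length (f k) = k"
    and hd_eq: "0 < k \<Longrightarrow> hd (f k) = w (k - 1)" by auto
  have "f k = [] \<or> hd (f k) \<noteq> w k"
    using length_eq hd_eq word(2)[of "k - 1"] by (cases k) auto
  then have "f (Suc k) = w k # f k"
    using walk_step reduced length_eq Suc.prems by (auto simp: toggle_def)
  moreover have "f (Suc k) \<in> reduced_words I L"
    unfolding walk_step using word(1) reduced by (rule toggle_reduced_words)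
  ultimately show ?case using length_eq by simp
qed

text \<open>Biggs' construction: the permutations of the vertices of a truncated regular tree, with the
  involutions that walk along the edges of a fixed colour. A short cycle would be a reduced word
  fixing the root.\<close>

lemma free_involutions_toggle:
  assumes "finite I" "0 < L"
  shows "free_involutions {p. p permutes reduced_words I L} I (\<lambda>i p. toggle I L i \<circ> p)"
proof
  have toggle_root: "toggle I L i [] = [i]" for i
    using assms(2) by (simp add: toggle_def)
  fix i p assume permutation: "p \<in> {p. p permutes reduced_words I L}"
  then obtain t where root: "p t = []" using permutes_surj by (metis mem_Collect_eq surj_def)
  have image_t: "(toggle I L k \<circ> p) t = [k]" for k using root toggle_root by simp
  then show "toggle I L i \<circ> p \<noteq> p" using root by (metis list.distinct(1))
  show "i = j" if "toggle I L i \<circ> p = toggle I L j \<circ> p" for j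
    using image_t[of i] image_t[of j] unfolding that by simp
  assume "i \<in> I"
  then show "toggle I L i \<circ> p \<in> {p. p permutes reduced_words I L}"
    using permutation toggle_permutes[of i I L] by (simp add: permutes_compose)
  show "toggle I L i \<circ> (toggle I L i \<circ> p) = p"
    using toggle_toggle[OF \<open>i \<in> I\<close>] by (simp add: fun_eq_iff)
qed (use assms finite_permutations finite_reduced_words in auto)

lemma regular_sparse_graph_exists:
  assumes "finite I"
  obtains V :: "('i list \<Rightarrow> 'i list) set" and E where
    "finite V" "V \<noteq> {}" "edge_set E" "\<Union>E \<subseteq> V" "\<forall>v\<in>V. card (incident E v) = card (I :: 'i set)"
    "sparse L E" "I \<noteq> {} \<longrightarrow> (\<exists>M\<subseteq>E. disjoint M \<and> \<Union>M = V)"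
proof -
  let ?V = "{p. p permutes reduced_words I (Suc L)}" and ?s = "\<lambda>i p. toggle I (Suc L) i \<circ> p"
  interpret free_involutions ?V I ?s using assms by (rule free_involutions_toggle) simp
  let ?E = "involution_edges ?s I ?V"
  show thesis
  proof
    show "?V \<noteq> {}" using permutes_id by blast
    show "\<Union>?E \<subseteq> ?V" using involution_edge_subset by (rule Union_least)
    show "I \<noteq> {} \<longrightarrow> (\<exists>M\<subseteq>?E. disjoint M \<and> \<Union>M = ?V)"
      using involution_perfect_matching by (metis ex_in_conv)
    show "sparse L ?E"
    proof (rule sparse_if_no_short_cycle)
      show "card e = 2" if "e \<in> ?E" for e
        using edge_set_involution_edges that by (rule edge_set_card)
      fix vs assume cycle: "is_cycle (?V, ?E) vs"
      let ?p = "\<lambda>k. vs ! (k mod length vs)"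
      obtain w where word: "\<And>k. w k \<in> I" "\<And>k. w (Suc k) \<noteq> w k" "\<And>k. ?p (Suc k) = ?s (w k) (?p k)"
        using involution_cycle_word[OF cycle] by metis
      have "{?p 0, vs ! (Suc 0 mod length vs)} \<in> ?E"
        using cycle by (auto simp: is_cycle_def dest!: spec[of _ 0])
      then have "?p 0 \<in> ?V" using involution_edge_subset by blast
      then obtain t where start_root: "?p 0 t = []"
        using permutes_surj by (metis mem_Collect_eq surj_def)
      show "L < length vs"
      proof (rule ccontr)
        assume "\<not> L < length vs"
        then have "length (?p (length vs) t) = length vs"
          using toggle_walk[of "\<lambda>k. ?p k t" I "Suc L" w "length vs"] start_root word by simp
        then show False using start_root cycle by (simp add: is_cycle_def)
      qed
    qed
  qed (use finite_V edge_set_involution_edges card_incident_involution_edges in simp_all)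
qed

section \<open>Regular graphs without uniform colourings\<close>

definition subdivide :: "'a set set \<Rightarrow> 'a \<Rightarrow> 'a \<Rightarrow> 'a \<Rightarrow> 'a set set" where
  "subdivide E u v x = insert {u, x} (insert {v, x} (E - {{u, v}}))"

context
  fixes E :: "'a set set" and u v x :: 'a
  assumes edge_set_E: "edge_set E" and edge_uv: "{u, v} \<in> E" and x_new: "x \<notin> \<Union>E"
begin

lemma subdivide_vertices_neq: "u \<noteq> v" "u \<noteq> x" "v \<noteq> x"
  using edge_set_neq[OF edge_set_E edge_uv] edge_uv x_new by auto

lemma edge_set_subdivide: "edge_set (subdivide E u v x)"
  unfolding subdivide_def edge_set_insert
  using subdivide_vertices_neq edge_set_subset[OF edge_set_E] by blast

lemma Union_subdivide: "\<Union>(subdivide E u v x) = insert x (\<Union>E)"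
  using edge_uv by (auto simp: subdivide_def)

lemma incident_subdivide_new: "incident (subdivide E u v x) x = {{u, x}, {v, x}}"
  using x_new by (auto simp: subdivide_def)

lemma card_incident_subdivide:
  assumes "p \<noteq> x"
  shows "card (incident (subdivide E u v x) p) = card (incident E p)"
proof -
  let ?H = "subdivide E u v x"
  show ?thesis
  proof (cases "p \<in> {u, v}")
    case True
    then have "incident ?H p = insert {p, x} (incident E p - {{u, v}})"
      using subdivide_vertices_neq by (auto simp: subdivide_def incident_insert incident_Diff)
    moreover have "{p, x} \<notin> incident E p" using x_new by auto
    ultimately have "card (incident ?H p) = Suc (card (incident E p - {{u, v}}))"
      using finite_incident[OF edge_set_E] by simp
    also have "\<dots> = card (incident E p)"
      using True edge_uv finite_incident[OF edge_set_E] by (intro card_Suc_Diff1) auto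
    finally show ?thesis .
  next
    case False
    then have "incident ?H p = incident E p" using assms by (auto simp: subdivide_def)
    then show ?thesis by simp
  qed
qed

lemma sparse_subdivide:
  assumes "sparse L E"
  shows "sparse L (subdivide E u v x)"
  unfolding sparse_def
proof (intro allI impI, elim conjE)
  fix C assume C_small: "C \<subseteq> subdivide E u v x" "finite C" "C \<noteq> {}" "card C \<le> L"
  show "card C < card (\<Union>C)"
  proof (cases "{{u, x}, {v, x}} \<subseteq> C")
    case True
    let ?B = "insert {u, v} (C - {{u, x}, {v, x}})"
    have "{u, v} \<notin> C"
      using C_small(1) subdivide_vertices_neq by (auto simp: subdivide_def doubleton_eq_iff)
    then have card_C: "card C = Suc (card ?B)"
      using True C_small(2) card_mono[OF C_small(2) True] subdivide_vertices_neq
      by (simp add: card_Diff_subset doubleton_eq_iff)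
    have "?B \<subseteq> E" using C_small(1) edge_uv by (auto simp: subdivide_def)
    moreover have "\<Union>C = insert x (\<Union>?B)" using True by auto
    ultimately have "card (\<Union>C) = Suc (card (\<Union>?B))"
      using x_new finite_Union_edge_set[OF edge_set_subset[OF edge_set_E]]
      by (metis Union_mono card_insert_disjoint subsetD)
    moreover have "card ?B < card (\<Union>?B)"
      using assms \<open>?B \<subseteq> E\<close> by (rule sparseD) (use C_small card_C in auto)
    ultimately show ?thesis using card_C by simp
  next
    case False
    then have "\<exists>y\<in>{u, v}. C \<subseteq> (E - {{u, v}}) \<union> {{y, x}}"
      using C_small(1) by (auto simp: subdivide_def)
    then obtain y where one_half: "C \<subseteq> (E - {{u, v}}) \<union> {{y, x}}" "y \<in> {u, v}" by blast
    have "sparse L ((E - {{u, v}}) \<union> {{y, x}})"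
    proof (rule sparse_Un)
      show "sparse L (E - {{u, v}})" using assms by (rule sparse_antimono) auto
      show "sparse L {{y, x}}"
        using one_half(2) subdivide_vertices_neq by (intro sparse_singleton) auto
      show "\<Union>(E - {{u, v}}) \<inter> \<Union>{{y, x}} \<subseteq> {y}" using x_new by auto
    qed
    then show ?thesis using one_half(1) C_small(2-4) by (rule sparseD)
  qed
qed

text \<open>If all colour sets along edges agreed, the old vertices seeing the colour of \<^term>\<open>{u, x}\<close> would
  be a union of components of \<^term>\<open>E\<close>, of even size by the perfect matching, while the edges of that
  colour would pair up these vertices together with \<^term>\<open>x\<close>.\<close>

lemma subdivide_colours_differ:
  assumes perfect_matching: "M \<subseteq> E" "disjoint M" "\<Union>M = \<Union>E"
    and proper: "proper_colouring (subdivide E u v x) c"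
  shows "\<exists>p q. {p, q} \<in> E \<and>
    colours_at (subdivide E u v x) c p \<noteq> colours_at (subdivide E u v x) c q"
proof (rule ccontr)
  let ?H = "subdivide E u v x" and ?k = "c {u, x}"
  assume uniform: "\<not> ?thesis"
  define B where "B = {p \<in> \<Union>E. ?k \<in> colours_at ?H c p}"
  have "B \<subseteq> \<Union>E" by (auto simp: B_def)
  then have finite_B: "finite B" using finite_Union_edge_set[OF edge_set_E] by (rule finite_subset)
  have "even (card B)"
  proof (rule even_card_closed_under_matching[OF edge_set_E finite_B perfect_matching(1,2)])
    show "B \<subseteq> \<Union>M" using \<open>B \<subseteq> \<Union>E\<close> perfect_matching(3) by simp
    show "q \<in> B" if "{p, q} \<in> E" "p \<in> B" for p q
      using that uniform unfolding B_def by blast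
  qed
  moreover have "even (card (\<Union>{e \<in> ?H. c e = ?k}))"
    using edge_set_subset[OF edge_set_subdivide] disjoint_colour_class[OF proper]
    by (intro even_card_Union_matching) auto
  moreover have "\<Union>{e \<in> ?H. c e = ?k} = insert x B"
  proof -
    have "?k \<in> colours_at ?H c x" by (rule in_colours_atI) (simp_all add: subdivide_def)
    moreover have "p \<in> insert x (\<Union>E)" if "?k \<in> colours_at ?H c p" for p
      using that unfolding Union_subdivide[symmetric] in_colours_at_iff by blast
    ultimately show ?thesis unfolding Union_colour_class B_def by blast
  qed
  moreover have "x \<notin> B" using x_new by (simp add: B_def)
  ultimately show False using finite_B by simp
qed

end

definition no_uniform_colouring :: "'a set set \<Rightarrow> bool" where
  "no_uniform_colouring G \<longleftrightarrow> (\<forall>c :: 'a set \<Rightarrow> nat. proper_colouring G c \<longrightarrow>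
     (\<exists>a b. {a, b} \<in> G \<and> colours_at G c a \<noteq> colours_at G c b))"

text \<open>A copy of a \<open>d\<close>-regular \<^term>\<open>E\<close> with its edge \<^term>\<open>{u, v}\<close> subdivided by \<^term>\<open>q\<close> raises the degree
  of \<^term>\<open>q\<close> by two, so the vertices of a \<open>d - 2\<close>-regular graph \<^term>\<open>Q\<close> are completed to degree \<open>d\<close>.\<close>

definition pendant :: "'b set set \<Rightarrow> 'b \<Rightarrow> 'b \<Rightarrow> 'a \<Rightarrow> ('a + 'a \<times> 'b) set set" where
  "pendant E u v q = subdivide ((`) (\<lambda>p. Inr (q, p)) ` E) (Inr (q, u)) (Inr (q, v)) (Inl q)"

definition attach_pendants ::
  "'a set \<Rightarrow> 'a set set \<Rightarrow> 'b set set \<Rightarrow> 'b \<Rightarrow> 'b \<Rightarrow> ('a + 'a \<times> 'b) set set" where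
  "attach_pendants V Q E u v = (`) Inl ` Q \<union> (\<Union>q\<in>V. pendant E u v q)"

context
  fixes V :: "'a set" and Q :: "'a set set" and E :: "'b set set" and u v :: 'b
  assumes vertices_Q: "finite V" "\<Union>Q \<subseteq> V" and edge_set_Q: "edge_set Q" and edge_set_E: "edge_set E"
    and edge_uv: "{u, v} \<in> E"
begin

lemma inj_Inr_Pair: "inj_on (\<lambda>p. Inr (q, p)) A"
  by (auto intro: inj_onI)

lemma pendant_copy:
  "edge_set ((`) (\<lambda>p. Inr (q, p)) ` E)" "{Inr (q, u), Inr (q, v)} \<in> (`) (\<lambda>p. Inr (q, p)) ` E"
  "Inl q \<notin> \<Union>((`) (\<lambda>p. Inr (q, p)) ` E)"
  using edge_set_image[OF inj_Inr_Pair edge_set_E] edge_uv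
  by (auto intro: image_eqI[of _ _ "{u, v}"])

lemma Union_pendant: "\<Union>(pendant E u v q) = insert (Inl q) ((\<lambda>p. Inr (q, p)) ` \<Union>E)"
  unfolding pendant_def Union_subdivide[OF pendant_copy] by auto

lemma pendant_vertex_index:
  "e \<in> pendant E u v r \<Longrightarrow> Inl q \<in> e \<Longrightarrow> q = r"
  "e \<in> pendant E u v r \<Longrightarrow> Inr (q, p) \<in> e \<Longrightarrow> q = r"
  using Union_pendant[of r] by blast+

lemma edge_set_attach_pendants: "edge_set (attach_pendants V Q E u v)"
proof -
  have "edge_set (pendant E u v q)" for q :: 'a
    unfolding pendant_def by (rule edge_set_subdivide[OF pendant_copy])
  moreover have "edge_set ((`) Inl ` Q)" using edge_set_Q by (auto intro: edge_set_image)
  ultimately show ?thesis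
    using vertices_Q(1) by (auto simp: attach_pendants_def edge_set_def)
qed

lemma incident_attach_pendants_Inr:
  "q \<in> V \<Longrightarrow>
    incident (attach_pendants V Q E u v) (Inr (q, p)) = incident (pendant E u v q) (Inr (q, p))"
  using pendant_vertex_index(2) by (fastforce simp: attach_pendants_def)

lemma incident_attach_pendants_Inl:
  assumes "q \<in> V"
  shows "incident (attach_pendants V Q E u v) (Inl q)
    = (`) Inl ` incident Q q \<union> {{Inr (q, u), Inl q}, {Inr (q, v), Inl q}}"
proof -
  have "incident (attach_pendants V Q E u v) (Inl q)
      = incident ((`) Inl ` Q) (Inl q) \<union> incident (pendant E u v q) (Inl q)"
    using assms pendant_vertex_index(1) by (fastforce simp: attach_pendants_def)
  moreover have "incident ((`) Inl ` Q) (Inl q :: 'a + 'a \<times> 'b) = (`) Inl ` incident Q q"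
    by (rule incident_image[of _ UNIV]) auto
  moreover have "incident (pendant E u v q) (Inl q) = {{Inr (q, u), Inl q}, {Inr (q, v), Inl q}}"
    unfolding pendant_def by (rule incident_subdivide_new[OF pendant_copy])
  ultimately show ?thesis by simp
qed

lemma Union_attach_pendants: "\<Union>(attach_pendants V Q E u v) = Inl ` V \<union> Inr ` (V \<times> \<Union>E)"
proof -
  have "\<Union>(attach_pendants V Q E u v) = Inl ` \<Union>Q \<union> (\<Union>q\<in>V. \<Union>(pendant E u v q))"
    unfolding attach_pendants_def by blast
  then show ?thesis unfolding Union_pendant using vertices_Q(2) by (auto simp: image_iff)
qed

lemma card_incident_attach_pendants:
  assumes Q_regular: "\<And>q. q \<in> V \<Longrightarrow> card (incident Q q) + 2 = d"
    and E_regular: "\<And>p. p \<in> \<Union>E \<Longrightarrow> card (incident E p) = d"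
    and vertex_a: "a \<in> \<Union>(attach_pendants V Q E u v)"
  shows "card (incident (attach_pendants V Q E u v) a) = d"
proof -
  consider (centre) q where "q \<in> V" "a = Inl q" | (copy) q p where "q \<in> V" "p \<in> \<Union>E" "a = Inr (q, p)"
    using vertex_a unfolding Union_attach_pendants by blast
  then show ?thesis
  proof cases
    case (centre q)
    let ?old = "(`) Inl ` incident Q q :: ('a + 'a \<times> 'b) set set"
    let ?links = "{{Inr (q, u), Inl q}, {Inr (q, v), Inl q}} :: ('a + 'a \<times> 'b) set set"
    have "?old \<inter> ?links = {}" by auto
    then have "card (?old \<union> ?links) = card ?old + card ?links"
      by (intro card_Un_disjoint) (simp_all add: finite_incident[OF edge_set_Q])
    moreover have "card ?old = card (incident Q q)"
      by (intro card_image inj_on_image) auto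
    moreover have "card ?links = 2"
      using edge_set_neq[OF edge_set_E edge_uv] by (auto simp: doubleton_eq_iff)
    moreover have "incident (attach_pendants V Q E u v) a = ?old \<union> ?links"
      unfolding centre(2) by (rule incident_attach_pendants_Inl[OF centre(1)])
    ultimately show ?thesis using Q_regular[OF centre(1)] by simp
  next
    case (copy q p)
    let ?f = "\<lambda>p. Inr (q, p) :: 'a + 'a \<times> 'b"
    have "card (incident (attach_pendants V Q E u v) a) = card (incident ((`) ?f ` E) (?f p))"
      unfolding copy(3) incident_attach_pendants_Inr[OF copy(1)] pendant_def
      by (rule card_incident_subdivide[OF pendant_copy]) simp
    also have "\<dots> = card (incident E p)"
      by (rule card_incident_image[OF inj_Inr_Pair]) auto
    finally show ?thesis using E_regular[OF copy(2)] by simp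
  qed
qed

lemma sparse_attach_pendants:
  assumes "sparse L Q" "sparse L E"
  shows "sparse L (attach_pendants V Q E u v)"
  unfolding attach_pendants_def
proof (rule sparse_Un_UN[where x = Inl])
  show "sparse L ((`) Inl ` Q)" using assms(1) by (intro sparse_image) auto
  show "sparse L (pendant E u v q)" for q
    unfolding pendant_def using sparse_image[OF inj_Inr_Pair assms(2)]
    by (rule sparse_subdivide[OF pendant_copy])
qed (auto simp: vertices_Q(1) Union_pendant)

lemma no_uniform_colouring_attach_pendants:
  assumes perfect_matching: "M \<subseteq> E" "disjoint M" "\<Union>M = \<Union>E" and "V \<noteq> {}"
  shows "no_uniform_colouring (attach_pendants V Q E u v)"
  unfolding no_uniform_colouring_def
proof (intro allI impI)
  let ?G = "attach_pendants V Q E u v"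
  fix c :: "('a + 'a \<times> 'b) set \<Rightarrow> nat" assume proper: "proper_colouring ?G c"
  obtain q where q_vertex: "q \<in> V" using \<open>V \<noteq> {}\<close> by blast
  let ?f = "\<lambda>p. Inr (q, p) :: 'a + 'a \<times> 'b" and ?H = "pendant E u v q"
  have pendant_subset: "?H \<subseteq> ?G" using q_vertex by (auto simp: attach_pendants_def)
  have pendant_local: "colours_at ?G c (?f p) = colours_at ?H c (?f p)" for p
    by (simp add: colours_at_def incident_attach_pendants_Inr[OF q_vertex])
  have image_M: "(`) ?f ` M \<subseteq> (`) ?f ` E" "disjoint ((`) ?f ` M)" "\<Union>((`) ?f ` M) = \<Union>((`) ?f ` E)"
    using perfect_matching disjoint_image[OF inj_Inr_Pair] by (auto simp flip: image_Union)
  have "\<exists>a b. {a, b} \<in> (`) ?f ` E \<and> colours_at ?H c a \<noteq> colours_at ?H c b"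
    unfolding pendant_def
    by (rule subdivide_colours_differ[OF pendant_copy image_M])
      (use proper_colouring_subset[OF proper pendant_subset] in \<open>simp add: pendant_def\<close>)
  then obtain a b e where "{a, b} = ?f ` e" "e \<in> E"
    and colours_differ: "colours_at ?H c a \<noteq> colours_at ?H c b"
    by blast
  moreover from this have "a \<in> ?f ` e" "b \<in> ?f ` e" by blast+
  ultimately obtain p r where preimages: "a = ?f p" "b = ?f r" "{?f p, ?f r} \<in> (`) ?f ` E" by blast
  then have differ: "colours_at ?G c (?f p) \<noteq> colours_at ?G c (?f r)"
    using colours_differ pendant_local by simp
  show "\<exists>a b. {a, b} \<in> ?G \<and> colours_at ?G c a \<noteq> colours_at ?G c b"
  proof (cases "{?f p, ?f r} = {?f u, ?f v}")
    case True
    then have "colours_at ?G c (?f u) \<noteq> colours_at ?G c (?f v)"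
      using differ by (auto simp: doubleton_eq_iff)
    moreover have "{?f u, Inl q} \<in> ?G" "{?f v, Inl q} \<in> ?G"
      using pendant_subset by (auto simp: pendant_def subdivide_def)
    ultimately show ?thesis by metis
  next
    case False
    then have "{?f p, ?f r} \<in> ?H" using preimages(3) by (simp only: pendant_def subdivide_def) blast
    then have "{?f p, ?f r} \<in> ?G" using pendant_subset by blast
    then show ?thesis using differ by blast
  qed
qed

end

lemma regular_graph_without_uniform_colouring_exists:
  assumes "2 \<le> d"
  obtains G :: "((nat list \<Rightarrow> nat list) + (nat list \<Rightarrow> nat list) \<times> (nat list \<Rightarrow> nat list)) set set"
    where
    "edge_set G" "\<forall>a\<in>\<Union>G. card (incident G a) = d" "no_uniform_colouring G" "sparse L G"
proof -
  obtain V :: "(nat list \<Rightarrow> nat list) set"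
    and Q where graph_Q: "finite V" "V \<noteq> {}" "edge_set Q" "\<Union>Q \<subseteq> V"
    and regular_Q: "\<forall>q\<in>V. card (incident Q q) = card {..<d - 2}" "sparse L Q"
    and "{..<d - 2} \<noteq> {} \<longrightarrow> (\<exists>M\<subseteq>Q. disjoint M \<and> \<Union>M = V)"
    by (rule regular_sparse_graph_exists[OF finite_lessThan])
  obtain W :: "(nat list \<Rightarrow> nat list) set"
    and E where graph_E: "finite W" "W \<noteq> {}" "edge_set E" "\<Union>E \<subseteq> W"
    and regular_E: "\<forall>p\<in>W. card (incident E p) = card {..<d}" "sparse L E"
    and matching: "{..<d} \<noteq> {} \<longrightarrow> (\<exists>M\<subseteq>E. disjoint M \<and> \<Union>M = W)"
    by (rule regular_sparse_graph_exists[OF finite_lessThan])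
  have "0 \<in> {..<d}" using assms by simp
  then obtain M where perfect_matching: "M \<subseteq> E" "disjoint M" "\<Union>M = W"
    using matching by (metis empty_iff)
  then obtain e where "e \<in> E" using graph_E(2) by blast
  then obtain u v where edge_uv: "{u, v} \<in> E"
    using edge_set_card[OF graph_E(3)] by (metis card_2_iff)
  have Union_matching: "\<Union>M = \<Union>E" using perfect_matching graph_E(4) by blast
  note pendants = graph_Q(1,4,3) graph_E(3) edge_uv
  let ?G = "attach_pendants V Q E u v"
  show thesis
  proof
    show "edge_set ?G" by (rule edge_set_attach_pendants[OF pendants])
    show "\<forall>a\<in>\<Union>?G. card (incident ?G a) = d"
      using regular_Q(1) regular_E(1) graph_E(4) assms
      by (intro ballI card_incident_attach_pendants[OF pendants]) auto
    show "sparse L ?G" by (rule sparse_attach_pendants[OF pendants regular_Q(2) regular_E(2)])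
    show "no_uniform_colouring ?G"
      by (rule no_uniform_colouring_attach_pendants[OF pendants perfect_matching(1,2)
            Union_matching graph_Q(2)])
  qed
qed

section \<open>Leaf extensions of forests\<close>

inductive leaf_extension :: "'a set \<Rightarrow> 'a set set \<Rightarrow> 'a set set \<Rightarrow> bool" for U A where
  base: "leaf_extension U A A"
| add_leaf: "leaf_extension U A B \<Longrightarrow> p \<noteq> q \<Longrightarrow> q \<notin> U \<Longrightarrow> q \<notin> \<Union>B \<Longrightarrow> leaf_extension U A (insert {p, q} B)"

lemma leaf_extension_subset: "leaf_extension U A B \<Longrightarrow> A \<subseteq> B"
  by (induction rule: leaf_extension.induct) auto

lemma leaf_extension_Diff:
  "leaf_extension U A B \<Longrightarrow> Z \<subseteq> A \<Longrightarrow> leaf_extension U (A - Z) (B - Z)"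
proof (induction rule: leaf_extension.induct)
  case base
  show ?case by (rule leaf_extension.base)
next
  case (add_leaf B p q)
  have "Z \<subseteq> B" using leaf_extension_subset[OF add_leaf.hyps(1)] add_leaf.prems by blast
  then have "insert {p, q} B - Z = insert {p, q} (B - Z)" using add_leaf.hyps(4) by blast
  moreover have "q \<notin> \<Union>(B - Z)" using add_leaf.hyps(4) by blast
  ultimately show ?case
    using leaf_extension.add_leaf[OF add_leaf.IH[OF add_leaf.prems] add_leaf.hyps(2,3)] by simp
qed

lemma low_degree_vertex_exists:
  assumes sparse_D: "edge_set D" "card D < card (\<Union>D)" and W_large: "W \<subseteq> \<Union>D" "card D \<le> card W"
  shows "\<exists>q\<in>W. card (incident D q) < 2"
proof (rule ccontr)
  assume "\<not> ?thesis"
  then have degree_ge_2: "2 \<le> card (incident D q)" if "q \<in> W" for q using that by (meson not_less)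
  have degree_ge_1: "1 \<le> card (incident D q)" if "q \<in> \<Union>D" for q
    using that finite_incident[OF sparse_D(1), of q] incident_eq_empty_iff[of D q]
    by (simp add: Suc_le_eq card_gt_0_iff)
  have finite_Union: "finite (\<Union>D)" using sparse_D(1) by (rule finite_Union_edge_set)
  have "card W * 2 \<le> (\<Sum>q\<in>W. card (incident D q))"
    using degree_ge_2 sum_bounded_below[of W "2 :: nat" "\<lambda>q. card (incident D q)"] by simp
  moreover have "card (\<Union>D - W) * 1 \<le> (\<Sum>q\<in>\<Union>D - W. card (incident D q))"
    using degree_ge_1 sum_bounded_below[of "\<Union>D - W" "1 :: nat" "\<lambda>q. card (incident D q)"] by simp
  moreover have "(\<Sum>q\<in>\<Union>D - W. card (incident D q)) + (\<Sum>q\<in>W. card (incident D q)) = 2 * card D"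
    using sum.subset_diff[OF W_large(1) finite_Union, of "\<lambda>q. card (incident D q)"]
      sum_card_incident[OF sparse_D(1) finite_Union order_refl] by simp
  moreover have "card (\<Union>D) = card (\<Union>D - W) + card W"
    using W_large(1) finite_Union card_mono[OF finite_Union W_large(1)]
    by (simp add: card_Diff_subset finite_subset)
  ultimately show False using sparse_D(2) W_large(2) by linarith
qed

lemma leaf_outside_subtree:
  assumes sparse_B: "edge_set B" "sparse (card B) B"
    and subtree_A: "A \<subset> B" "card (\<Union>A) \<le> Suc (card A)"
  obtains p q where "{p, q} \<in> B - A" "p \<noteq> q" "q \<notin> \<Union>(B - {{p, q}})"
proof -
  let ?D = "B - A" and ?W = "\<Union>B - \<Union>A"
  have edge_set_D: "edge_set ?D" and "edge_set A"
    using edge_set_subset[OF sparse_B(1)] subtree_A(1) by blast+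
  then have finite: "finite B" "finite (\<Union>B)" "finite (\<Union>A)"
    using sparse_B(1) finite_Union_edge_set by (auto simp: edge_set_def)
  have "card A \<le> card B" "card ?D = card B - card A"
    using finite(1) subtree_A(1) finite_subset[of A B] by (auto intro: card_mono card_Diff_subset)
  moreover have "card B < card (\<Union>B)"
    using sparse_B(2) subtree_A(1) finite(1) by (auto intro: sparseD)
  moreover have "card (\<Union>B) \<le> card ?W + card (\<Union>A)"
    using finite(2,3) card_Un_le[of ?W "\<Union>A"] card_mono[of "?W \<union> \<Union>A" "\<Union>B"] by simp
  ultimately have "card ?D \<le> card ?W" using subtree_A(2) by linarith
  moreover have "card ?D < card (\<Union>?D)"
    using sparse_B(2) subtree_A(1) finite(1) card_mono[OF finite(1), of ?D]
    by (intro sparseD[of "card B" B]) auto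
  moreover have "?W \<subseteq> \<Union>?D" by blast
  ultimately obtain q where q_low_degree: "q \<in> ?W" "card (incident ?D q) < 2"
    using low_degree_vertex_exists[OF edge_set_D, of ?W] by blast
  then obtain e where e_at_q: "e \<in> ?D" "q \<in> e" by blast
  then obtain p where e_eq: "e = {q, p}" "p \<noteq> q" using edge_at_vertexE[OF edge_set_D] by metis
  have "f = e" if "f \<in> B" "q \<in> f" for f
  proof -
    have "f \<in> incident ?D q" "e \<in> incident ?D q" using that q_low_degree(1) e_at_q by auto
    then show ?thesis
      using q_low_degree(2) card_le_Suc0_iff_eq[OF finite_incident[OF edge_set_D, of q]] by simp
  qed
  then have "q \<notin> \<Union>(B - {e})" by blast
  then show thesis using that[of p q] e_at_q(1) e_eq by (simp add: insert_commute)
qed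

lemma leaf_extension_of_subtree:
  assumes "edge_set B" "\<And>L. sparse L B" "A \<subseteq> B" "card (\<Union>A) \<le> Suc (card A)"
  shows "leaf_extension (\<Union>A) A B"
  using assms
proof (induction "card B" arbitrary: B rule: less_induct)
  case less
  show ?case
  proof (cases "A = B")
    case True
    then show ?thesis by (simp add: leaf_extension.base)
  next
    case False
    then obtain p q where leaf_edge: "{p, q} \<in> B - A" "p \<noteq> q" "q \<notin> \<Union>(B - {{p, q}})"
      using leaf_outside_subtree[of B A] less.prems by blast
    let ?B = "B - {{p, q}}"
    have "card ?B < card B"
      using less.prems(1) leaf_edge(1)
      by (auto simp: edge_set_def intro!: card_Diff1_less simp del: card_Diff_insert)
    then have "leaf_extension (\<Union>A) A ?B"
      using less.prems leaf_edge(1)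
      by (intro less.hyps) (auto intro: edge_set_subset sparse_antimono)
    moreover have "q \<notin> \<Union>A" using leaf_edge(1,3) less.prems(3) by blast
    ultimately have "leaf_extension (\<Union>A) A (insert {p, q} ?B)"
      using leaf_edge(2,3) by (intro leaf_extension.add_leaf)
    then show ?thesis using leaf_edge(1) by (simp add: insert_absorb)
  qed
qed

lemma sparse_insert_between_components:
  assumes sparse_E: "edge_set E" "sparse L E" and x_outside: "x \<notin> component E y"
  shows "sparse L (insert {y, x} E)"
proof -
  define A where "A = {e \<in> E. e \<subseteq> component E y}"
  define B where "B = E - A"
  have inside: "\<Union>A \<subseteq> component E y" by (auto simp: A_def)
  have outside: "\<Union>B \<inter> component E y = {}"
    using component_closed[OF sparse_E(1), of _ _ y] by (auto simp: A_def B_def)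
  have sparse_parts: "sparse L A" "sparse L B"
    using sparse_E(2) by (auto simp: A_def B_def intro: sparse_antimono)
  have "x \<noteq> y" using x_outside by auto
  have "sparse L ({{y, x}} \<union> B)"
  proof (rule sparse_Un)
    show "sparse L {{y, x}}" using \<open>x \<noteq> y\<close> by (intro sparse_singleton) auto
    show "\<Union>{{y, x}} \<inter> \<Union>B \<subseteq> {x}" using outside self_in_component[of y E] by auto
  qed (rule sparse_parts)
  moreover have "\<Union>({{y, x}} \<union> B) \<inter> \<Union>A \<subseteq> {y}" using inside outside x_outside by auto
  ultimately have "sparse L ({{y, x}} \<union> B \<union> A)" by (rule sparse_Un[OF _ sparse_parts(1)])
  moreover have "{{y, x}} \<union> B \<union> A = insert {y, x} E" by (auto simp: A_def B_def)
  ultimately show ?thesis by simp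
qed

text \<open>If \<^term>\<open>{y, x}\<close> is not an edge, adding it to the forest still makes \<^term>\<open>{{y, x}, {x, w}}\<close> a subtree
  that can be extended leaf by leaf.\<close>

lemma leaf_extension_path:
  assumes sparse_E: "edge_set E" "\<And>L. sparse L E" and edge_xw: "{x, w} \<in> E" "x \<noteq> y" "w \<noteq> y"
    and adjacent: "{y, x} \<in> E \<or> x \<notin> component E y"
  shows "leaf_extension {y, x, w} ({{y, x}, {x, w}} \<inter> E) E"
proof -
  let ?path = "{{y, x}, {x, w}}" and ?E = "insert {y, x} E"
  have "x \<noteq> w" using sparse_E(1) edge_xw(1) by (rule edge_set_neq)
  have vertices: "\<Union>?path = {y, x, w}" by auto
  have "leaf_extension (\<Union>?path) ?path ?E"
  proof (rule leaf_extension_of_subtree)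
    show "edge_set ?E" using sparse_E(1) edge_xw(2) by (simp add: edge_set_insert)
    show "sparse L ?E" for L
      using adjacent sparse_insert_between_components[OF sparse_E] sparse_E(2)
      by (auto simp: insert_absorb)
    have "card ?path = 2" using edge_xw by (simp add: doubleton_eq_iff)
    moreover have "card (\<Union>?path) = 3" unfolding vertices using edge_xw(2,3) \<open>x \<noteq> w\<close> by simp
    ultimately show "card (\<Union>?path) \<le> Suc (card ?path)" by simp
  qed (use edge_xw(1) in blast)
  then have "leaf_extension (\<Union>?path) (?path - ({{y, x}} - E)) (?E - ({{y, x}} - E))"
    by (rule leaf_extension_Diff) blast
  moreover have "?path - ({{y, x}} - E) = ?path \<inter> E" using edge_xw(1) by blast
  moreover have "?E - ({{y, x}} - E) = E" by blast
  ultimately show ?thesis unfolding vertices by simp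
qed

lemma edge_avoiding_vertexE:
  assumes edge_set_E: "edge_set E" and "e \<in> E" "y \<notin> e"
  obtains x w where "{x, w} \<in> E" "x \<noteq> y" "w \<noteq> y" "{y, x} \<in> E \<or> x \<notin> component E y"
proof (cases "\<exists>x w. {y, x} \<in> E \<and> {x, w} \<in> E \<and> w \<noteq> y")
  case True
  then show thesis using that edge_set_neq[OF edge_set_E] by metis
next
  case False
  have component: "v = y \<or> {y, v} \<in> E" if "v \<in> component E y" for v
    using that
  proof (induction rule: component_induct)
    case (step a b)
    then show ?case using False by metis
  qed simp
  obtain x w where "e = {x, w}"
    using edge_set_card[OF edge_set_E assms(2)] by (auto simp: card_2_iff)
  then have "x \<noteq> y" "w \<noteq> y" "{x, w} \<in> E" using assms(2,3) by auto
  moreover from this have "x \<notin> component E y" using component False by blast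
  ultimately show thesis using that by blast
qed

section \<open>Greedy rainbow embeddings\<close>

definition rainbow_hom :: "'a set set \<Rightarrow> 'b set set \<Rightarrow> ('b set \<Rightarrow> 'c) \<Rightarrow> ('a \<Rightarrow> 'b) \<Rightarrow> bool" where
  "rainbow_hom A G c f \<longleftrightarrow> (\<forall>e\<in>A. f ` e \<in> G) \<and> inj_on (\<lambda>e. c (f ` e)) A"

lemma rainbow_hom_cong:
  assumes "\<And>e. e \<in> A \<Longrightarrow> f ` e = g ` e"
  shows "rainbow_hom A G c f \<longleftrightarrow> rainbow_hom A G c g"
  unfolding rainbow_hom_def using assms by (simp cong: inj_on_cong)

lemma rainbow_hom_insert:
  "rainbow_hom (insert e A) G c f \<longleftrightarrow>
     f ` e \<in> G \<and> rainbow_hom A G c f \<and> c (f ` e) \<notin> (\<lambda>e. c (f ` e)) ` (A - {e})"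
  by (auto simp: rainbow_hom_def)

lemma rainbow_hom_inj_on_edges: "rainbow_hom A G c f \<Longrightarrow> inj_on ((`) f) A"
  unfolding rainbow_hom_def by (metis (no_types, lifting) inj_onD inj_onI)

lemma rainbow_hom_add_leaf:
  assumes hom_f: "rainbow_hom B G c f" and q_new: "q \<notin> \<Union>B" "p \<noteq> q" and edge_set_G: "edge_set G"
    and fewer: "card ((\<lambda>e. c (f ` e)) ` B \<inter> colours_at G c (f p)) < card (colours_at G c (f p))"
  obtains t where "{f p, t} \<in> G" "rainbow_hom (insert {p, q} B) G c (f(q := t))"
proof -
  let ?used = "(\<lambda>e. c (f ` e)) ` B"
  have "\<not> colours_at G c (f p) \<subseteq> ?used" using fewer by (metis Int_absorb1 less_irrefl)
  then obtain k where "k \<in> colours_at G c (f p)" "k \<notin> ?used" by blast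
  then obtain t where t_edge: "{f p, t} \<in> G" "c {f p, t} \<notin> ?used"
    using in_colours_atE[OF edge_set_G] by metis
  have image_old: "(f(q := t)) ` e = f ` e" if "e \<in> B" for e
    using that q_new(1) by (intro image_cong) auto
  then have "rainbow_hom B G c (f(q := t))"
    using hom_f rainbow_hom_cong[of B "f(q := t)" f] by blast
  moreover have "(f(q := t)) ` {p, q} = {f p, t}" using q_new(2) by auto
  moreover have "(\<lambda>e. c ((f(q := t)) ` e)) ` B = ?used" by (simp only: image_old cong: image_cong)
  moreover have "B - {{p, q}} = B" using q_new(1) by blast
  ultimately have "rainbow_hom (insert {p, q} B) G c (f(q := t))"
    unfolding rainbow_hom_insert using t_edge by metis
  then show thesis using that t_edge(1) by blast
qed

lemma greedy_rainbow_hom: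
  assumes proper_G: "edge_set G" "proper_colouring G c"
    and allowed: "\<And>p q a b. {p, q} \<in> A \<Longrightarrow> a \<in> allowed p \<Longrightarrow> {a, b} \<in> G \<Longrightarrow> b \<in> allowed q"
    and degree_ge: "\<And>v a. v \<in> \<Union>A \<Longrightarrow> a \<in> allowed v \<Longrightarrow> card A \<le> card (incident G a)"
    and start: "rainbow_hom A0 G c f0" "\<And>v. f0 v \<in> allowed v"
    and extension: "leaf_extension U A0 A" and "finite A"
  shows "\<exists>f. rainbow_hom A G c f \<and> (\<forall>v\<in>U. f v = f0 v) \<and> (\<forall>v. f v \<in> allowed v)"
proof -
  have "\<exists>f. rainbow_hom B G c f \<and> (\<forall>v\<in>U. f v = f0 v) \<and> (\<forall>v. f v \<in> allowed v)"
    if "leaf_extension U A0 B" "B \<subseteq> A" for B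
    using that
  proof (induction rule: leaf_extension.induct)
    case base
    then show ?case using start by blast
  next
    case (add_leaf B p q)
    then obtain f where hom_f: "rainbow_hom B G c f" "\<And>v. v \<in> U \<Longrightarrow> f v = f0 v" "\<And>v. f v \<in> allowed v"
      by blast
    let ?used = "(\<lambda>e. c (f ` e)) ` B"
    have edge_pq: "{p, q} \<in> A" "B \<subset> A" using add_leaf by blast+
    have finite_B: "finite B" using edge_pq(2) \<open>finite A\<close> by (meson finite_subset less_imp_le)
    then have "card (?used \<inter> colours_at G c (f p)) \<le> card ?used" by (intro card_mono) auto
    also have "\<dots> \<le> card B" using finite_B by (rule card_image_le)
    also have "\<dots> < card A" using \<open>finite A\<close> edge_pq(2) by (rule psubset_card_mono)
    also have "\<dots> \<le> card (colours_at G c (f p))"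
      unfolding card_colours_at[OF proper_G(2)] using edge_pq(1) hom_f(3) by (intro degree_ge) auto
    finally obtain t where t_edge: "{f p, t} \<in> G" "rainbow_hom (insert {p, q} B) G c (f(q := t))"
      by (rule rainbow_hom_add_leaf[OF hom_f(1) add_leaf.hyps(4,2) proper_G(1)])
    have "t \<in> allowed q" using edge_pq(1) hom_f(3) t_edge(1) by (rule allowed)
    then have "\<forall>v. (f(q := t)) v \<in> allowed v" "\<forall>v\<in>U. (f(q := t)) v = f0 v"
      using hom_f(2,3) add_leaf.hyps(3) by auto
    then show ?case using t_edge(2) by blast
  qed
  then show ?thesis using extension by blast
qed

text \<open>A rainbow homomorphism does not identify edges, so it maps a component with \<open>m\<close> edges, hence
  at most \<open>m + 1\<close> vertices, onto \<open>m\<close> edges, which by sparsity span at least \<open>m + 1\<close> vertices.\<close>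

lemma rainbow_hom_inj_on_component:
  assumes edge_set_A: "edge_set A" "card A \<le> L" and "sparse L G" and hom_f: "rainbow_hom A G c f"
  shows "inj_on f (component A v)"
proof -
  let ?K = "component A v"
  let ?B = "{e \<in> A. e \<subseteq> ?K}"
  have finite_K: "finite ?K" using edge_set_A(1) by (rule finite_component)
  have finite_B: "finite ?B" using edge_set_A(1) by (simp add: edge_set_def)
  have "card ?K \<le> card (f ` ?K)"
  proof (cases "?B = {}")
    case True
    then have "card ?K \<le> 1"
      using card_component_le[OF edge_set_A(1), of v] by (metis One_nat_def card.empty)
    moreover have "card (f ` ?K) \<noteq> 0"
      using finite_K by (simp add: card_eq_0_iff) (metis empty_iff self_in_component)
    ultimately show ?thesis by linarith
  next
    case False
    let ?C = "(`) f ` ?B"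
    have "inj_on ((`) f) ?B" using rainbow_hom_inj_on_edges[OF hom_f] by (rule inj_on_subset) blast
    then have card_C: "card ?C = card ?B" by (rule card_image)
    have "card ?B \<le> L" using edge_set_A card_mono[of A ?B] by (auto simp: edge_set_def)
    moreover have "?C \<subseteq> G" using hom_f by (auto simp: rainbow_hom_def)
    ultimately have "card ?C < card (\<Union>?C)"
      using finite_B False card_C by (intro sparseD[OF \<open>sparse L G\<close>]) auto
    also have "\<dots> \<le> card (f ` ?K)" using finite_K by (intro card_mono) auto
    finally show ?thesis using card_component_le[OF edge_set_A(1), of v] card_C by linarith
  qed
  then have "card (f ` ?K) = card ?K" using card_image_le[OF finite_K, of f] by linarith
  then show ?thesis using finite_K by (simp add: eq_card_imp_inj_on)
qed

section \<open>Embedding forests into disjoint copies\<close>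

definition copies :: "'i set \<Rightarrow> 'b set set \<Rightarrow> ('i \<times> 'b) set set" where
  "copies I G = (\<Union>i\<in>I. (`) (Pair i) ` G)"

lemma inj_on_Pair: "inj_on (Pair i) A"
  by (auto intro: inj_onI)

lemma edge_set_copies:
  assumes "finite I" "edge_set G"
  shows "edge_set (copies I G)"
proof -
  have "edge_set ((`) (Pair i) ` G)" for i :: 'a
    using inj_on_Pair assms(2) by (rule edge_set_image)
  then show ?thesis using assms(1) by (auto simp: edge_set_def copies_def)
qed

lemma Union_copies: "\<Union>(copies I G) = I \<times> \<Union>G"
  by (auto simp: copies_def)

lemma copies_edge_iff: "{(i, a), (j, b)} \<in> copies I G \<longleftrightarrow> i = j \<and> i \<in> I \<and> {a, b} \<in> G"
proof
  assume "{(i, a), (j, b)} \<in> copies I G"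
  then obtain k e where e_copy: "k \<in> I" "e \<in> G" "{(i, a), (j, b)} = Pair k ` e"
    by (auto simp: copies_def)
  then have "(i, a) \<in> Pair k ` e" "(j, b) \<in> Pair k ` e" by blast+
  then have same_index: "i = k" "j = k" by auto
  then have "Pair k ` {a, b} = Pair k ` e" using e_copy(3) by simp
  then have "{a, b} = e" using inj_image_eq_iff[OF inj_on_Pair] by metis
  then show "i = j \<and> i \<in> I \<and> {a, b} \<in> G" using same_index e_copy by simp
next
  assume "i = j \<and> i \<in> I \<and> {a, b} \<in> G"
  then have "{(i, a), (j, b)} = Pair i ` {a, b}" "i \<in> I" "{a, b} \<in> G" by auto
  then show "{(i, a), (j, b)} \<in> copies I G" unfolding copies_def by blast
qed

lemma copy_subset_copies: "i \<in> I \<Longrightarrow> (`) (Pair i) ` G \<subseteq> copies I G"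
  by (auto simp: copies_def)

lemma incident_copies: "i \<in> I \<Longrightarrow> incident (copies I G) (i, a) = incident ((`) (Pair i) ` G) (i, a)"
  by (fastforce simp: copies_def)

lemma card_incident_copies: "i \<in> I \<Longrightarrow> card (incident (copies I G) (i, a)) = card (incident G a)"
  by (simp add: incident_copies card_incident_image[OF inj_on_Pair subset_UNIV UNIV_I])

lemma sparse_copies:
  assumes "finite I" "sparse L G"
  shows "sparse L (copies I G)"
proof -
  have "sparse L ((`) (Pair i) ` G)" for i :: 'a
    using inj_on_Pair assms(2) by (rule sparse_image)
  moreover have "sparse L {}" by (simp add: sparse_def)
  ultimately have "sparse L ({} \<union> (\<Union>i\<in>I. (`) (Pair i) ` G))"
    using assms(1) by (intro sparse_Un_UN) auto
  then show ?thesis by (simp add: copies_def)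
qed

lemma copy_colours_differ:
  fixes c :: "('i \<times> 'b) set \<Rightarrow> nat"
  assumes "no_uniform_colouring G" "proper_colouring (copies I G) c" "i \<in> I"
  obtains a b
    where "{a, b} \<in> G" "colours_at (copies I G) c (i, a) \<noteq> colours_at (copies I G) c (i, b)"
proof -
  have "proper_colouring ((`) (Pair i) ` G) c"
    using assms(2) copy_subset_copies[OF assms(3)] by (rule proper_colouring_subset)
  then have "proper_colouring G (c \<circ> (`) (Pair i))"
    by (rule proper_colouring_comp_image[OF inj_on_Pair subset_UNIV])
  then obtain a b where "{a, b} \<in> G"
    "colours_at G (c \<circ> (`) (Pair i)) a \<noteq> colours_at G (c \<circ> (`) (Pair i)) b"
    using assms(1) unfolding no_uniform_colouring_def by blast
  moreover have "colours_at (copies I G) c (i, v) = colours_at G (c \<circ> (`) (Pair i)) v" for v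
    using colours_at_image[OF inj_on_Pair[of i UNIV] subset_UNIV UNIV_I, of G c v]
    by (simp add: colours_at_def incident_copies[OF assms(3)])
  ultimately show thesis using that by simp
qed

locale forest_and_copies =
  fixes E :: "'a set set" and G :: "'b set set" and d :: nat and I :: "'a set set"
    and c :: "('a set \<times> 'b) set \<Rightarrow> nat"
  assumes edge_set_E: "edge_set E" and sparse_E: "\<And>L. sparse L E" and card_E: "card E = Suc d"
    and edge_set_G: "edge_set G" and G_regular: "\<And>a. a \<in> \<Union>G \<Longrightarrow> card (incident G a) = d"
    and no_uniform: "no_uniform_colouring G"
    and index_I: "finite I" "\<And>v. v \<in> \<Union>E \<Longrightarrow> component E v \<in> I"
    and proper: "proper_colouring (copies I G) c"
begin

abbreviation "host \<equiv> copies I G"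

lemma edge_set_host: "edge_set host"
  using index_I(1) edge_set_G by (rule edge_set_copies)

lemma card_colours_at_host: "i \<in> I \<Longrightarrow> a \<in> \<Union>G \<Longrightarrow> card (colours_at host c (i, a)) = d"
  by (simp add: card_colours_at[OF proper] card_incident_copies G_regular)

lemma fresh_colour_edge:
  assumes i_index: "i \<in> I" and j_index: "j \<in> I"
  obtains a b t where "a \<in> \<Union>G" "{b, t} \<in> G" "c {(j, b), (j, t)} \<notin> colours_at host c (i, a)"
    "i = j \<Longrightarrow> {a, b} \<in> G"
proof -
  have fresh: "\<exists>t. {b, t} \<in> G \<and> c {(j, b), (j, t)} \<notin> colours_at host c (i, a)"
    if ab_differ: "a \<in> \<Union>G" "b \<in> \<Union>G" "colours_at host c (j, b) \<noteq> colours_at host c (i, a)" for a b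
  proof -
    have "\<not> colours_at host c (j, b) \<subseteq> colours_at host c (i, a)"
      using card_subset_eq[OF finite_colours_at[OF edge_set_host]] card_colours_at_host i_index
        j_index ab_differ
      by metis
    then obtain k where k_fresh: "k \<in> colours_at host c (j, b)" "k \<notin> colours_at host c (i, a)"
      by blast
    then obtain s where s_edge: "{(j, b), s} \<in> host" "c {(j, b), s} = k"
      using in_colours_atE[OF edge_set_host] by metis
    then have "s = (j, snd s)" "{b, snd s} \<in> G"
      using copies_edge_iff[of j b "fst s" "snd s"] by (auto simp: prod_eq_iff)
    then show ?thesis using s_edge(2) k_fresh(2) by metis
  qed
  obtain a b where ab_differ: "{a, b} \<in> G" "colours_at host c (j, a) \<noteq> colours_at host c (j, b)"
    using copy_colours_differ[OF no_uniform proper j_index] by metis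
  then have "a \<in> \<Union>G" "b \<in> \<Union>G" by blast+
  show thesis
  proof (cases "i = j")
    case True
    then obtain t where "{b, t} \<in> G" "c {(j, b), (j, t)} \<notin> colours_at host c (i, a)"
      using fresh[of a b] \<open>a \<in> \<Union>G\<close> \<open>b \<in> \<Union>G\<close> ab_differ(2) by auto
    then show thesis using that \<open>a \<in> \<Union>G\<close> ab_differ(1) by blast
  next
    case False
    obtain b' where "b' \<in> {a, b}" "colours_at host c (j, b') \<noteq> colours_at host c (i, a)"
      using ab_differ(2) by (metis insertI1 insertI2)
    then obtain t where "{b', t} \<in> G" "c {(j, b'), (j, t)} \<notin> colours_at host c (i, a)"
      using fresh[of a b'] \<open>a \<in> \<Union>G\<close> \<open>b \<in> \<Union>G\<close> by auto
    then show thesis using that \<open>a \<in> \<Union>G\<close> False by blast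
  qed
qed

lemma host_edge_respects_components:
  assumes "{p, q} \<in> E" "a \<in> {component E p} \<times> \<Union>G" "{a, b} \<in> host"
  shows "b \<in> {component E q} \<times> \<Union>G"
proof -
  obtain i a' j b' where pairs: "a = (i, a')" "b = (j, b')" by (cases a, cases b)
  then have "i = j" "{a', b'} \<in> G" using assms(3) by (simp_all add: copies_edge_iff)
  moreover have "i = component E q" using assms(2) pairs(1) component_edge[OF assms(1)] by simp
  ultimately show ?thesis using pairs(2) by blast
qed

text \<open>Once a colour missing at the image of \<^term>\<open>y\<close> has been used, at most \<open>d - 1\<close> of the \<open>d\<close> colours
  there are spent before the last edge \<^term>\<open>{y, z}\<close> is embedded.\<close>

lemma complete_rainbow_hom:
  assumes leaf_yz: "{y, z} \<in> E" "z \<notin> \<Union>(E - {{y, z}})"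
    and extension: "leaf_extension U A0 (E - {{y, z}})" "y \<in> U" "\<Union>A0 \<subseteq> U"
    and start: "rainbow_hom A0 host c f0" "\<And>v. f0 v \<in> {component E v} \<times> \<Union>G"
    and missing: "e0 \<in> A0" "c (f0 ` e0) \<notin> colours_at host c (f0 y)"
  shows "\<exists>f. rainbow_hom E host c f \<and> (\<forall>v. f v \<in> {component E v} \<times> \<Union>G)"
proof -
  let ?A = "E - {{y, z}}" and ?allowed = "\<lambda>v. {component E v} \<times> \<Union>G"
  have finite_A: "finite ?A" and card_A: "card ?A = d"
    using edge_set_E leaf_yz(1) card_E by (auto simp: edge_set_def)
  have colours: "card (colours_at host c a) = d" if "v \<in> \<Union>E" "a \<in> ?allowed v" for v a
    using that index_I(2) card_colours_at_host by auto
  have "\<exists>f. rainbow_hom ?A host c f \<and> (\<forall>v\<in>U. f v = f0 v) \<and> (\<forall>v. f v \<in> ?allowed v)"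
  proof (rule greedy_rainbow_hom[OF edge_set_host proper _ _ start extension(1) finite_A])
    show "b \<in> ?allowed q" if "{p, q} \<in> ?A" "a \<in> ?allowed p" "{a, b} \<in> host" for p q a b
      using DiffD1[OF that(1)] that(2,3) by (rule host_edge_respects_components)
    show "card ?A \<le> card (incident host a)" if "v \<in> \<Union>?A" "a \<in> ?allowed v" for v a
    proof -
      have "v \<in> \<Union>E" using that(1) by blast
      then show ?thesis
        using colours[of v a] that(2) card_A card_colours_at[OF proper, of a] by linarith
    qed
  qed
  then obtain f
    where hom_f: "rainbow_hom ?A host c f" "\<And>v. v \<in> U \<Longrightarrow> f v = f0 v" "\<And>v. f v \<in> ?allowed v"
    by blast
  let ?used = "(\<lambda>e. c (f ` e)) ` ?A"
  have "f ` e0 = f0 ` e0" using hom_f(2) extension(3) missing(1) by (intro image_cong) auto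
  then have "c (f ` e0) \<notin> colours_at host c (f y)" using missing(2) hom_f(2) extension(2) by simp
  moreover have "c (f ` e0) \<in> ?used"
    using leaf_extension_subset[OF extension(1)] missing(1) by blast
  ultimately have "card (?used \<inter> colours_at host c (f y)) < card ?used"
    using finite_A by (intro psubset_card_mono) auto
  also have "\<dots> \<le> d" using card_image_le[OF finite_A] card_A by metis
  also have "d = card (colours_at host c (f y))"
    using colours[OF _ hom_f(3), of y] leaf_yz(1) by auto
  finally obtain t
    where t_edge: "{f y, t} \<in> host" "rainbow_hom (insert {y, z} ?A) host c (f(z := t))"
    by (rule rainbow_hom_add_leaf[OF hom_f(1) leaf_yz(2) edge_set_neq[OF edge_set_E leaf_yz(1)]
          edge_set_host])
  have "rainbow_hom E host c (f(z := t))" using t_edge(2) leaf_yz(1) by (simp add: insert_absorb)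
  moreover have "t \<in> ?allowed z"
    using leaf_yz(1) hom_f(3) t_edge(1) by (rule host_edge_respects_components)
  ultimately show ?thesis using hom_f(3) by (intro exI[of _ "f(z := t)"]) auto
qed

lemma path_rainbow_hom:
  assumes y_vertex: "y \<in> \<Union>E" and edge_xw: "{x, w} \<in> E" "x \<noteq> y" "w \<noteq> y"
  obtains f where "rainbow_hom ({{y, x}, {x, w}} \<inter> E) host c f" "\<And>v. f v \<in> {component E v} \<times> \<Union>G"
    "c (f ` {x, w}) \<notin> colours_at host c (f y)"
proof -
  let ?i = "component E y" and ?j = "component E x"
  have indices: "?i \<in> I" "?j \<in> I" using index_I(2) y_vertex edge_xw(1) by blast+
  have "x \<noteq> w" using edge_set_E edge_xw(1) by (rule edge_set_neq)
  have component_w: "component E w = ?j" using component_edge[OF edge_xw(1)] by simp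
  obtain a b t where fresh: "a \<in> \<Union>G" "{b, t} \<in> G" "c {(?j, b), (?j, t)} \<notin> colours_at host c (?i, a)"
    and ab_adjacent: "?i = ?j \<Longrightarrow> {a, b} \<in> G"
    using fresh_colour_edge[OF indices] by metis
  define f where "f v = (component E v, if v = x then b else if v = w then t else a)" for v
  have f_images: "f y = (?i, a)" "f ` {y, x} = {(?i, a), (?j, b)}" "f ` {x, w} = {(?j, b), (?j, t)}"
    using edge_xw(2,3) \<open>x \<noteq> w\<close> component_w by (simp_all add: f_def)
  have "f ` {x, w} \<in> host"
    using indices(2) fresh(2) unfolding f_images by (simp add: copies_edge_iff)
  then have "rainbow_hom {{x, w}} host c f" by (simp add: rainbow_hom_def del: image_insert)
  moreover have "f ` {y, x} \<in> host \<and> c (f ` {y, x}) \<noteq> c (f ` {x, w})" if "{y, x} \<in> E"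
  proof -
    have "?i = ?j" using that by (rule component_edge)
    then have "f ` {y, x} \<in> host"
      using ab_adjacent indices(1) unfolding f_images by (simp add: copies_edge_iff)
    moreover from this have "c (f ` {y, x}) \<in> colours_at host c (?i, a)"
      by (rule in_colours_atI) (simp only: f_images insertI1)
    ultimately show ?thesis using fresh(3) f_images(3) by metis
  qed
  ultimately have "rainbow_hom ({{y, x}, {x, w}} \<inter> E) host c f"
    using edge_xw(1)
    by (cases "{y, x} \<in> E") (auto simp: rainbow_hom_insert Int_insert_left simp del: image_insert)
  moreover have "f v \<in> {component E v} \<times> \<Union>G" for v using fresh(1,2) by (auto simp: f_def)
  moreover have "c (f ` {x, w}) \<notin> colours_at host c (f y)" using fresh(3) f_images by simp
  ultimately show thesis using that by blast
qed

lemma forest_rainbow_hom: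
  assumes leaf_yz: "{y, z} \<in> E" "z \<notin> \<Union>(E - {{y, z}})" and "e \<in> E" "y \<notin> e"
  shows "\<exists>f. rainbow_hom E host c f \<and> (\<forall>v. f v \<in> {component E v} \<times> \<Union>G)"
proof -
  let ?A = "E - {{y, z}}"
  have edge_set_A: "edge_set ?A" and sparse_A: "sparse L ?A" for L
    using edge_set_E sparse_E by (auto intro: edge_set_subset sparse_antimono)
  obtain x w where edge_xw: "{x, w} \<in> E" "x \<noteq> y" "w \<noteq> y" "{y, x} \<in> E \<or> x \<notin> component E y"
    using edge_avoiding_vertexE[OF edge_set_E assms(3,4)] by metis
  let ?path = "{{y, x}, {x, w}}"
  have xw_A: "{x, w} \<in> ?A" using edge_xw by (auto simp: doubleton_eq_iff)
  then have "x \<noteq> z" using leaf_yz(2) by blast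
  then have path_A: "?path \<inter> ?A = ?path \<inter> E" using edge_xw(2,3) by (auto simp: doubleton_eq_iff)
  have "y \<in> \<Union>E" using leaf_yz(1) by blast
  then obtain f where hom_f: "rainbow_hom (?path \<inter> E) host c f" "\<And>v. f v \<in> {component E v} \<times> \<Union>G"
    "c (f ` {x, w}) \<notin> colours_at host c (f y)"
    using path_rainbow_hom[OF _ edge_xw(1-3)] by metis
  have "component ?A y \<subseteq> component E y" by (intro component_mono) blast
  then have "{y, x} \<in> ?A \<or> x \<notin> component ?A y" using edge_xw(4) path_A by blast
  then have "leaf_extension {y, x, w} (?path \<inter> E) ?A"
    using leaf_extension_path[OF edge_set_A sparse_A xw_A edge_xw(2,3)] unfolding path_A by blast
  then show ?thesis
    by (rule complete_rainbow_hom[OF leaf_yz _ _ _ hom_f(1,2) _ hom_f(3)]) (use edge_xw(1) in auto)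
qed

lemma forest_rainbow_embedding:
  assumes "{y, z} \<in> E" "z \<notin> \<Union>(E - {{y, z}})" "e \<in> E" "y \<notin> e" and G_sparse: "sparse (Suc d) G"
  shows "\<exists>f. inj f \<and> rainbow_hom E host c f \<and> (\<forall>v. f v \<in> {component E v} \<times> \<Union>G)"
proof -
  obtain f where hom_f: "rainbow_hom E host c f" "\<And>v. f v \<in> {component E v} \<times> \<Union>G"
    using forest_rainbow_hom[OF assms(1-4)] by blast
  have "u = v" if "f u = f v" for u v
  proof -
    have "component E u = component E v" using hom_f(2)[of u] hom_f(2)[of v] that by auto
    then have "v \<in> component E u" by simp
    moreover have "inj_on f (component E u)"
      by (rule rainbow_hom_inj_on_component[OF edge_set_E _
            sparse_copies[OF index_I(1) G_sparse] hom_f(1)])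
        (simp add: card_E)
    ultimately show ?thesis using that by (meson inj_onD self_in_component)
  qed
  then have "inj f" by (rule injI)
  then show ?thesis using hom_f by blast
qed

end

section \<open>Degree anti-Ramsey numbers\<close>

lemma simple_graph_iff:
  "simple_graph G \<longleftrightarrow> finite (verts G) \<and> edge_set (edges G) \<and> \<Union>(edges G) \<subseteq> verts G"
proof
  assume simple: "simple_graph G"
  then have "edges G \<subseteq> Pow (verts G)" "finite (verts G)" by (auto simp: simple_graph_def)
  then have "finite (edges G)" by (meson finite_Pow_iff finite_subset)
  then show "finite (verts G) \<and> edge_set (edges G) \<and> \<Union>(edges G) \<subseteq> verts G"
    using simple by (auto simp: simple_graph_def edge_set_def)
qed (auto simp: simple_graph_def edge_set_def)

lemma max_degree_le_iff:
  assumes "simple_graph G"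
  shows "max_degree_le G k \<longleftrightarrow> (\<forall>v. card (incident (edges G) v) \<le> k)"
proof -
  have "incident (edges G) v = {}" if "v \<notin> verts G" for v
    using assms that unfolding incident_eq_empty_iff simple_graph_iff by blast
  then show ?thesis by (metis card.empty degree_def incident_def max_degree_le_def zero_le)
qed

definition map_graph :: "('a \<Rightarrow> 'b) \<Rightarrow> 'a ugraph \<Rightarrow> 'b ugraph" where
  "map_graph f G = (f ` verts G, (`) f ` edges G)"

lemma simple_graph_map_graph:
  assumes "simple_graph G" "inj_on f (verts G)"
  shows "simple_graph (map_graph f G)"
proof -
  have "inj_on f (\<Union>(edges G))" using assms by (auto simp: simple_graph_iff intro: inj_on_subset)
  then have "edge_set ((`) f ` edges G)"
    using assms(1) by (simp add: edge_set_image simple_graph_iff)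
  then show ?thesis using assms(1) by (auto simp: simple_graph_iff map_graph_def)
qed

lemma max_degree_le_map_graph:
  assumes "simple_graph G" "inj_on f (verts G)" "max_degree_le G k"
  shows "max_degree_le (map_graph f G) k"
  unfolding max_degree_le_def
proof
  fix w assume "w \<in> verts (map_graph f G)"
  then obtain v where preimage_v: "v \<in> verts G" "w = f v" by (auto simp: map_graph_def)
  have "degree (map_graph f G) w = card (incident ((`) f ` edges G) (f v))"
    by (simp add: degree_def incident_def map_graph_def preimage_v(2))
  also have "\<dots> = card (incident (edges G) v)"
    using assms(1,2) preimage_v(1) by (intro card_incident_image) (auto simp: simple_graph_iff)
  also have "\<dots> \<le> k" using assms(3) max_degree_le_iff[OF assms(1)] by blast
  finally show "degree (map_graph f G) w \<le> k" .
qed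

lemma has_rainbow_copy_iff:
  assumes simple_F: "simple_graph F"
  shows "has_rainbow_copy F G c \<longleftrightarrow>
    (\<exists>f. inj_on f (verts F) \<and> f ` verts F \<subseteq> verts G \<and> rainbow_hom (edges F) (edges G) c f)"
proof
  assume "has_rainbow_copy F G c"
  then obtain H f where rainbow_H: "subgraph H G" "rainbow c H"
    and hom_f: "bij_betw f (verts F) (verts H)"
    "edges H = (`) f ` edges F"
    unfolding has_rainbow_copy_def isomorphic_def by blast
  have inj_f: "inj_on f (verts F)" using hom_f(1) by (simp add: bij_betw_def)
  then have "inj_on ((`) f) (edges F)"
    using simple_F by (auto simp: simple_graph_iff intro: inj_on_image_edges)
  then have "inj_on (c \<circ> (`) f) (edges F)"
    using rainbow_H(2) hom_f(2) unfolding rainbow_def by (intro comp_inj_on) simp_all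
  then have "rainbow_hom (edges F) (edges G) c f"
    using rainbow_H(1) hom_f(2) unfolding rainbow_hom_def subgraph_def comp_def by blast
  then show "\<exists>f. inj_on f (verts F) \<and> f ` verts F \<subseteq> verts G \<and> rainbow_hom (edges F) (edges G) c f"
    using inj_f hom_f(1) rainbow_H(1) unfolding bij_betw_def subgraph_def by blast
next
  assume "\<exists>f. inj_on f (verts F) \<and> f ` verts F \<subseteq> verts G \<and> rainbow_hom (edges F) (edges G) c f"
  then obtain f
    where hom_f: "inj_on f (verts F)" "f ` verts F \<subseteq> verts G" "rainbow_hom (edges F) (edges G) c f"
    by blast
  have "subgraph (map_graph f F) G"
    using hom_f simple_graph_map_graph[OF simple_F hom_f(1)]
    by (auto simp: subgraph_def map_graph_def rainbow_hom_def)
  moreover have "isomorphic F (map_graph f F)"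
    using hom_f(1) unfolding isomorphic_def map_graph_def by (auto simp: bij_betw_def)
  moreover have "rainbow c (map_graph f F)"
    using hom_f(3) by (auto simp: rainbow_def map_graph_def rainbow_hom_def inj_on_def)
  ultimately show "has_rainbow_copy F G c" unfolding has_rainbow_copy_def by blast
qed

definition forces_rainbow :: "'a ugraph \<Rightarrow> nat \<Rightarrow> 'b ugraph \<Rightarrow> bool" where
  "forces_rainbow F k G \<longleftrightarrow> simple_graph G \<and> max_degree_le G k \<and>
     (\<forall>c :: 'b set \<Rightarrow> nat. proper_edge_colouring G c \<longrightarrow> has_rainbow_copy F G c)"

lemma forces_rainbow_homE:
  fixes c :: "'b set \<Rightarrow> nat"
  assumes "simple_graph F" "forces_rainbow F k G" "proper_colouring (edges G) c"
  obtains f where "inj_on f (verts F)" "f ` verts F \<subseteq> verts G" "rainbow_hom (edges F) (edges G) c f"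
proof -
  have "has_rainbow_copy F G c"
    using assms(2,3) by (simp add: forces_rainbow_def proper_edge_colouring_iff)
  then show thesis using that unfolding has_rainbow_copy_iff[OF assms(1)] by blast
qed

lemma forces_rainbow_map_graph:
  assumes simple_F: "simple_graph F" and forcing_G: "forces_rainbow F k G"
    and inj_g: "inj_on g (verts G)"
  shows "forces_rainbow F k (map_graph g G)"
  unfolding forces_rainbow_def
proof (intro conjI allI impI)
  have simple: "simple_graph G" and degree: "max_degree_le G k"
    using forcing_G by (simp_all add: forces_rainbow_def)
  show "simple_graph (map_graph g G)" using simple inj_g by (rule simple_graph_map_graph)
  show "max_degree_le (map_graph g G) k" using simple inj_g degree by (rule max_degree_le_map_graph)
  fix c :: "'c set \<Rightarrow> nat" assume "proper_edge_colouring (map_graph g G) c"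
  then have "proper_colouring ((`) g ` edges G) c"
    by (simp add: proper_edge_colouring_iff map_graph_def)
  then have "proper_colouring (edges G) (c \<circ> (`) g)"
    using inj_g simple by (auto simp: simple_graph_iff intro: proper_colouring_comp_image)
  then obtain f where hom_f: "inj_on f (verts F)" "f ` verts F \<subseteq> verts G"
    "rainbow_hom (edges F) (edges G) (c \<circ> (`) g) f"
    by (rule forces_rainbow_homE[OF simple_F forcing_G])
  have "inj_on (g \<circ> f) (verts F)" using hom_f(1,2) inj_g by (meson comp_inj_on inj_on_subset)
  moreover have "rainbow_hom (edges F) (edges (map_graph g G)) c (g \<circ> f)"
    using hom_f(3) unfolding rainbow_hom_def map_graph_def image_comp[symmetric] by simp
  ultimately show "has_rainbow_copy F (map_graph g G) c"
    unfolding has_rainbow_copy_iff[OF simple_F] using hom_f(2)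
    by (intro exI[of _ "g \<circ> f"]) (auto simp: map_graph_def)
qed

lemma AR_d_eqI:
  fixes G :: "'b ugraph"
  assumes simple_F: "simple_graph F" and forcing_G: "forces_rainbow F k G"
    and lower: "\<And>j (G :: nat ugraph). forces_rainbow F j G \<Longrightarrow> k \<le> j"
  shows "AR_d F = k"
proof -
  have "finite (verts G)" using forcing_G by (simp add: forces_rainbow_def simple_graph_def)
  then obtain g :: "'b \<Rightarrow> nat" where "inj_on g (verts G)" using finite_imp_inj_to_nat_seg by metis
  then have "forces_rainbow F k (map_graph g G)"
    by (rule forces_rainbow_map_graph[OF simple_F forcing_G])
  then have "(LEAST k. \<exists>G :: nat ugraph. forces_rainbow F k G) = k"
    using lower by (intro Least_equality) blast+
  then show ?thesis by (simp add: AR_d_def forces_rainbow_def)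
qed

lemma forces_rainbow_lower_bound:
  fixes G :: "'b ugraph"
  assumes simple_F: "simple_graph F" and forcing_G: "forces_rainbow F k G"
  shows "num_edges F - 1 \<le> k"
proof -
  have "simple_graph G" "max_degree_le G k" using forcing_G by (simp_all add: forces_rainbow_def)
  then have "edge_set (edges G)" "card (incident (edges G) v) < card {..k}" for v
    using max_degree_le_iff[of G k] by (simp_all add: simple_graph_iff less_Suc_eq_le)
  then obtain c where colouring: "edge_colouring (edges G) {..k} c" using Vizing by metis
  then have "proper_colouring (edges G) c" by (simp add: edge_colouring_def)
  then obtain f where hom_f: "rainbow_hom (edges F) (edges G) c f"
    by (rule forces_rainbow_homE[OF simple_F forcing_G])
  then have "card (edges F) = card ((\<lambda>e. c (f ` e)) ` edges F)"
    unfolding rainbow_hom_def by (simp add: card_image)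
  also have "\<dots> \<le> card {..k}"
    using hom_f colouring unfolding rainbow_hom_def edge_colouring_def by (intro card_mono) auto
  finally show ?thesis by (simp add: num_edges_def)
qed

lemma AR_d_common_vertex:
  assumes simple_F: "simple_graph F" and common_z: "\<forall>e\<in>edges F. z \<in> e"
  shows "AR_d F = num_edges F"
proof (rule AR_d_eqI[OF simple_F])
  have "edge_set (edges F)" using simple_F by (simp add: simple_graph_iff)
  then have "card (incident (edges F) v) \<le> num_edges F" for v
    unfolding num_edges_def by (intro card_mono) (auto simp: edge_set_def)
  moreover have "has_rainbow_copy F F c" if "proper_colouring (edges F) c" for c :: "'a set \<Rightarrow> nat"
  proof -
    have "inj_on c (edges F)" using that common_z by (auto intro!: inj_onI dest: proper_colouringD)
    then show ?thesis
      unfolding has_rainbow_copy_iff[OF simple_F] rainbow_hom_def by (intro exI[of _ id]) simp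
  qed
  ultimately show "forces_rainbow F (num_edges F) F"
    using simple_F by (simp add: forces_rainbow_def max_degree_le_iff proper_edge_colouring_iff)
next
  fix j and G :: "nat ugraph" assume forcing_G: "forces_rainbow F j G"
  then have "simple_graph G" and degree: "card (incident (edges G) v) \<le> j" for v
    by (auto simp: forces_rainbow_def max_degree_le_iff)
  then have "edge_set (edges G)" by (simp add: simple_graph_iff)
  then obtain c :: "nat set \<Rightarrow> nat" where "inj_on c (edges G)"
    using finite_imp_inj_to_nat_seg by (metis edge_set_def)
  then have "proper_colouring (edges G) c" by (auto intro: proper_colouringI dest: inj_onD)
  then obtain f where hom_f: "rainbow_hom (edges F) (edges G) c f"
    by (rule forces_rainbow_homE[OF simple_F forcing_G])
  have "num_edges F = card ((`) f ` edges F)"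
    using rainbow_hom_inj_on_edges[OF hom_f] by (simp add: num_edges_def card_image)
  also have "\<dots> \<le> card (incident (edges G) (f z))"
    using hom_f common_z finite_incident[OF \<open>edge_set (edges G)\<close>]
    by (intro card_mono) (auto simp: rainbow_hom_def)
  finally show "num_edges F \<le> j" using degree order_trans by blast
qed

lemma forces_rainbow_two_edges_lower_bound:
  assumes two_edges_F: "simple_graph F" "num_edges F = 2" and forcing_G: "forces_rainbow F j G"
  shows "2 \<le> j"
proof (rule ccontr)
  assume "\<not> 2 \<le> j"
  have simple: "simple_graph G" and "max_degree_le G j"
    using forcing_G by (simp_all add: forces_rainbow_def)
  then have "card (incident (edges G) v) \<le> j" for v using max_degree_le_iff[OF simple] by blast
  also have "j \<le> 1" using \<open>\<not> 2 \<le> j\<close> by simp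
  finally have degree: "card (incident (edges G) v) \<le> 1" for v .
  have "proper_colouring (edges G) (\<lambda>_. 0 :: nat)"
  proof (rule proper_colouringI)
    fix e f v assume "e \<in> edges G" "f \<in> edges G" "v \<in> e" "v \<in> f"
    then show "e = f"
      using degree[of v] simple card_le_Suc0_iff_eq[OF finite_incident, of "edges G" v]
      by (simp add: simple_graph_iff)
  qed
  then obtain f where hom_f: "rainbow_hom (edges F) (edges G) (\<lambda>_. 0 :: nat) f"
    by (rule forces_rainbow_homE[OF two_edges_F(1) forcing_G])
  obtain e1 e2 where "edges F = {e1, e2}" "e1 \<noteq> e2"
    using two_edges_F(2) by (auto simp: num_edges_def card_2_iff)
  then show False using hom_f by (simp add: rainbow_hom_def inj_on_def)
qed

lemma two_matchingE:
  assumes simple_F: "simple_graph F" and matching: "is_matching F" "num_edges F = 2"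
  obtains a b p q where "edges F = {{a, b}, {p, q}}" "a \<noteq> b" "p \<noteq> q" "{a, b} \<inter> {p, q} = {}"
    "{a, b, p, q} \<subseteq> verts F"
proof -
  obtain e f where edges_F: "edges F = {e, f}" "e \<noteq> f"
    using matching(2) by (auto simp: num_edges_def card_2_iff)
  then have "card e = 2" "card f = 2" "e \<union> f \<subseteq> verts F"
    using simple_F by (auto simp: simple_graph_def)
  moreover have "e \<inter> f = {}" using matching(1) edges_F by (auto simp: is_matching_def)
  ultimately show thesis using that edges_F(1) by (auto simp: card_2_iff)
qed

text \<open>The host is \<^term>\<open>F\<close> with a second edge at one end of one of its two edges; these two edges have
  distinct colours, so one of them does not have the colour of the other edge of \<^term>\<open>F\<close>.\<close>

lemma AR_d_two_matching:
  assumes simple_F: "simple_graph F" and matching: "is_matching F" "num_edges F = 2"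
  shows "AR_d F = 2"
proof -
  obtain a b p q where edges_F: "edges F = {{a, b}, {p, q}}" "a \<noteq> b" "p \<noteq> q"
    and disjoint: "{a, b} \<inter> {p, q} = {}" and verts: "{a, b, p, q} \<subseteq> verts F"
    using two_matchingE[OF simple_F matching] by metis
  let ?new = "{Some a, None}" and ?ab = "{Some a, Some b}" and ?pq = "{Some p, Some q}"
  let ?G = "(insert None (Some ` verts F), {?ab, ?new, ?pq})"
  have simple: "simple_graph ?G" using simple_F verts edges_F(2,3) by (auto simp: simple_graph_def)
  have "card (incident {?ab, ?new, ?pq} v) \<le> 2" for v
  proof -
    have "incident {?ab, ?new, ?pq} v \<subseteq> {?ab, ?new} \<or> incident {?ab, ?new, ?pq} v \<subseteq> {?pq}"
      using disjoint by auto
    moreover have "card {?ab, ?new} \<le> 2" "card {?pq} \<le> 2" by (auto simp: card_insert_if)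
    ultimately show ?thesis by (meson card_mono finite.emptyI finite_insert order_trans)
  qed
  then have degree: "max_degree_le ?G 2" using simple by (simp add: max_degree_le_iff)
  have "has_rainbow_copy F ?G c" if proper: "proper_colouring {?ab, ?new, ?pq} c" for c :: "_ \<Rightarrow> nat"
  proof -
    have "c ?ab \<noteq> c ?new"
      using proper_colouringD[OF proper, of ?ab ?new "Some a"] by (auto simp: doubleton_eq_iff)
    define f where "f = (if c ?ab = c ?pq then Some(b := None) else Some)"
    have "f ` {a, b} = (if c ?ab = c ?pq then ?new else ?ab)" "f ` {p, q} = ?pq"
      using edges_F(2) disjoint by (auto simp: f_def)
    then have "rainbow_hom (edges F) (edges ?G) c f"
      using \<open>c ?ab \<noteq> c ?new\<close> unfolding edges_F(1) rainbow_hom_def inj_on_def by auto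
    moreover have "inj_on f (verts F)" "f ` verts F \<subseteq> verts ?G" by (auto simp: f_def inj_on_def)
    ultimately show ?thesis unfolding has_rainbow_copy_iff[OF simple_F] by blast
  qed
  then have "forces_rainbow F 2 ?G"
    using simple degree by (simp add: forces_rainbow_def proper_edge_colouring_iff)
  then show ?thesis
    by (rule AR_d_eqI[OF simple_F])
      (rule forces_rainbow_two_edges_lower_bound[OF simple_F matching(2)])
qed

lemma is_star_delete_isolated_iff:
  assumes simple_F: "simple_graph F"
  shows "is_star (delete_isolated F) \<longleftrightarrow> edges F \<noteq> {} \<and> (\<exists>z. \<forall>e\<in>edges F. z \<in> e)"
proof
  assume "is_star (delete_isolated F)"
  then show "edges F \<noteq> {} \<and> (\<exists>z. \<forall>e\<in>edges F. z \<in> e)"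
    unfolding is_star_def delete_isolated_def by auto
next
  assume "edges F \<noteq> {} \<and> (\<exists>z. \<forall>e\<in>edges F. z \<in> e)"
  then obtain z where nonempty: "edges F \<noteq> {}" and common_z: "\<And>e. e \<in> edges F \<Longrightarrow> z \<in> e" by blast
  have edge_set_F: "edge_set (edges F)" "\<Union>(edges F) \<subseteq> verts F" "finite (verts F)"
    using simple_F by (simp_all add: simple_graph_iff)
  let ?L = "{x. {z, x} \<in> edges F}"
  have "?L \<subseteq> verts F" using edge_set_F(2) by auto
  then have "finite ?L" using edge_set_F(3) by (rule finite_subset)
  moreover have edges: "edges F = (\<lambda>x. {z, x}) ` ?L"
    using edge_at_vertexE[OF edge_set_F(1)] common_z by (auto simp: image_iff) metis
  moreover have "?L \<noteq> {}" using nonempty edges by auto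
  moreover have "z \<notin> ?L" using edge_set_neq[OF edge_set_F(1)] by blast
  moreover have "\<Union>(edges F) = insert z ?L" using \<open>?L \<noteq> {}\<close> by (subst edges) auto
  then have "{v \<in> verts F. \<exists>e\<in>edges F. v \<in> e} = insert z ?L" using edge_set_F(2) by blast
  ultimately show "is_star (delete_isolated F)"
    unfolding is_star_def delete_isolated_def fst_conv snd_conv
    by (intro exI[of _ z] exI[of _ ?L] conjI)
qed

lemma three_le_num_edges:
  assumes simple_F: "simple_graph F" and "\<nexists>z. \<forall>e\<in>edges F. z \<in> e"
    and "\<not> (is_matching F \<and> num_edges F = 2)"
  shows "3 \<le> num_edges F"
proof (rule ccontr)
  have edge_set_F: "edge_set (edges F)" using simple_F by (simp add: simple_graph_iff)
  obtain e where e_edge: "e \<in> edges F" using assms(2) by blast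
  then obtain z where "z \<in> e" using edge_set_card[OF edge_set_F] by fastforce
  then obtain f where f_avoids_z: "f \<in> edges F" "z \<notin> f" using assms(2) by blast
  assume "\<not> 3 \<le> num_edges F"
  moreover have "e \<noteq> f" using f_avoids_z(2) \<open>z \<in> e\<close> by blast
  then have "card {e, f} = 2" by simp
  ultimately have edges: "edges F = {e, f}" "num_edges F = 2"
    using edge_set_F e_edge f_avoids_z card_mono[of "edges F" "{e, f}"]
      card_seteq[of "edges F" "{e, f}"]
    by (auto simp: num_edges_def edge_set_def)
  have "e \<inter> f = {}" using assms(2) edges(1) by blast
  then have "is_matching F" using edges(1) by (auto simp: is_matching_def)
  then show False using assms(3) edges(2) by blast
qed

lemma forest_sparse:
  assumes "forest F"
  shows "sparse L (edges F)"
proof (rule sparse_if_no_short_cycle)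
  show "card e = 2" if "e \<in> edges F" for e
    using assms that by (simp add: forest_def simple_graph_def)
  show "L < length vs" if "is_cycle (verts F, edges F) vs" for vs
    using assms that by (simp add: forest_def)
qed

lemma forest_leafE:
  assumes "forest F" "edges F \<noteq> {}"
  obtains y z where "{y, z} \<in> edges F" "z \<notin> \<Union>(edges F - {{y, z}})"
proof -
  have "edge_set (edges F)" using assms(1) by (simp add: forest_def simple_graph_iff)
  moreover have "{} \<subset> edges F" using assms(2) by blast
  ultimately obtain y z where "{y, z} \<in> edges F - {}" "z \<notin> \<Union>(edges F - {{y, z}})"
    using leaf_outside_subtree[of "edges F" "{}"] forest_sparse[OF assms(1)]
    by (metis Union_empty card.empty le0)
  then show thesis using that by simp
qed

lemma forces_rainbow_copies:
  assumes forest: "forest F" "num_edges F = Suc d" and nonstar: "\<nexists>z. \<forall>e\<in>edges F. z \<in> e"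
    and regular_G: "edge_set G" "\<forall>a\<in>\<Union>G. card (incident G a) = d" "no_uniform_colouring G"
    and sparse_G: "sparse (Suc d) G" and I_def: "I = component (edges F) ` verts F"
  shows "forces_rainbow F d (I \<times> \<Union>G, copies I G)"
  unfolding forces_rainbow_def
proof (intro conjI allI impI)
  let ?H = "(I \<times> \<Union>G, copies I G)"
  have simple_F: "simple_graph F" using forest(1) by (simp add: forest_def)
  then have edge_set_F: "edge_set (edges F)" "\<Union>(edges F) \<subseteq> verts F" and finite_I: "finite I"
    by (simp_all add: simple_graph_iff I_def)
  show "simple_graph ?H"
    using finite_I regular_G(1) finite_Union_edge_set[OF regular_G(1)]
    by (simp add: simple_graph_iff edge_set_copies Union_copies)
  show "max_degree_le ?H d"
    using regular_G(2)
    by (auto simp: max_degree_le_def degree_def card_incident_copies simp flip: incident_def)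
  fix c :: "('a set \<times> 'b) set \<Rightarrow> nat" assume proper_c: "proper_edge_colouring ?H c"
  interpret forest_and_copies "edges F" G d I c
    by unfold_locales
      (use proper_c edge_set_F forest(2) regular_G finite_I forest_sparse[OF forest(1)] in
        \<open>auto simp: I_def num_edges_def proper_edge_colouring_iff\<close>)
  have "edges F \<noteq> {}" using nonstar by blast
  then obtain y z where leaf_yz: "{y, z} \<in> edges F" "z \<notin> \<Union>(edges F - {{y, z}})"
    using forest_leafE[OF forest(1)] by metis
  obtain e where e_avoids_y: "e \<in> edges F" "y \<notin> e" using nonstar by blast
  obtain f where embedding: "inj f" "rainbow_hom (edges F) (copies I G) c f"
    "\<And>v. f v \<in> {component (edges F) v} \<times> \<Union>G"
    using forest_rainbow_embedding[OF leaf_yz e_avoids_y sparse_G] by blast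
  have "f v \<in> I \<times> \<Union>G" if "v \<in> verts F" for v
    using embedding(3)[of v] that by (cases "f v") (auto simp: I_def)
  then have "f ` verts F \<subseteq> verts ?H" unfolding fst_conv by (rule image_subsetI)
  moreover have "inj_on f (verts F)" using embedding(1) by (rule inj_on_subset) simp
  ultimately show "has_rainbow_copy F ?H c"
    unfolding has_rainbow_copy_iff[OF simple_F] using embedding(2) by auto
qed

lemma AR_d_forest:
  assumes forest: "forest F" and nonstar: "\<nexists>z. \<forall>e\<in>edges F. z \<in> e"
    and nonmatching: "\<not> (is_matching F \<and> num_edges F = 2)"
  shows "AR_d F = num_edges F - 1"
proof -
  have simple_F: "simple_graph F" using forest by (simp add: forest_def)
  define d where "d = num_edges F - 1"
  have d_size: "2 \<le> d" "num_edges F = Suc d"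
    using three_le_num_edges[OF simple_F nonstar nonmatching] by (auto simp: d_def)
  obtain G :: "((nat list \<Rightarrow> nat list) + (nat list \<Rightarrow> nat list) \<times> (nat list \<Rightarrow> nat list)) set set"
    where "edge_set G" "\<forall>a\<in>\<Union>G. card (incident G a) = d" "no_uniform_colouring G"
      and "sparse (Suc d) G"
    by (rule regular_graph_without_uniform_colouring_exists[OF d_size(1), of "Suc d"])
  note host = forces_rainbow_copies[OF forest d_size(2) nonstar this refl]
  show ?thesis
    unfolding d_def[symmetric]
    by (rule AR_d_eqI[OF simple_F host])
      (use forces_rainbow_lower_bound[OF simple_F] in \<open>simp add: d_def\<close>)
qed

theorem theorem1p3:
  fixes F :: "'a ugraph"
  assumes "forest F"
  shows "AR_d F =
    (if is_star (delete_isolated F) \<or> (is_matching F \<and> num_edges F = 2)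
     then num_edges F else num_edges F - 1)"
proof -
  have simple_F: "simple_graph F" using assms by (simp add: forest_def)
  show ?thesis
  proof (cases "\<exists>z. \<forall>e\<in>edges F. z \<in> e")
    case True
    moreover from this have "AR_d F = num_edges F" using AR_d_common_vertex[OF simple_F] by blast
    ultimately show ?thesis
      by (cases "edges F = {}")
        (simp_all add: is_star_delete_isolated_iff[OF simple_F] num_edges_def)
  next
    case False
    then show ?thesis
      using AR_d_two_matching[OF simple_F] AR_d_forest[OF assms]
        is_star_delete_isolated_iff[OF simple_F] by auto
  qed
qed

end
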